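(* Let $\Phi:\mathcal{L}(\mathcal{H})\to\mathcal{L}(\mathcal{K})$ be a quantum channel, and let $\mathscr{A}=\bigoplus_k\mathbb{M}_{d_k}(\mathbb{C})\subseteq\mathcal{L}(L)$ be represented in the standard (block-diagonal) way on $L=\bigoplus_k\mathbb{C}^{d_k}$. Then $\mathscr{A}$ is transmittable via $\Phi$ if and only if there exist quantum channels $\mathcal{E}:\mathcal{L}(L)\to\mathcal{L}(\mathcal{H})$ and $\mathcal{D}:\mathcal{L}(\mathcal{K})\to\mathcal{L}(L)$ such that $$\mathcal{D}\circ\Phi\circ\mathcal{E}=\mathcal{P}_{\mathscr{A}},$$ where $\mathcal{P}_{\mathscr{A}}(X)=\sum_kP_kXP_k$ is the unique trace-preserving conditional expectation onto $\mathscr{A}$ and $P_k$ is the orthogonal projection of $L$ onto its $k$th summand.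
   Context: All Hilbert spaces are finite-dimensional and complex; all $C^*$-algebras are finite-dimensional and nonzero. $\mathcal{L}(\mathcal{H})$ is the algebra of linear operators on $\mathcal{H}$. A quantum channel is a linear, completely positive, trace-preserving map $\Phi:\mathcal{L}(\mathcal{H})\to\mathcal{L}(\mathcal{K})$; its adjoint $\Phi^*$ is defined by $\mathrm{Tr}(Y\Phi(X))=\mathrm{Tr}(\Phi^*(Y)X)$. Correctability: a $*$-subalgebra $\mathscr{A}\subseteq\mathcal{L}(\mathcal{H})$ with unit projection $P$ (possibly $P\neq 1_{\mathcal{H}}$) is correctable for $\Phi$ if, with $C=P\mathcal{H}$, $V:C\to\mathcal{H}$ the inclusion and $\Phi|_C(Y)=\Phi(VYV^* )$, there is a channel $\mathcal{D}:\mathcal{L}(\mathcal{K})\to\mathcal{L}(C)$ with $(\mathcal{D}\circ\Phi|_C)^*(X)=X$ for all $X\in V^*\mathscr{A}V$. Transmittability: a $C^*$-algebra $\mathscr{A}$ is transmittable via $\Phi$ if there is an injective (not necessarily unital) $*$-homomorphism $\pi:\mathscr{A}\to\mathcal{L}(\mathcal{H})$ whose image is correctable for $\Phi$. *)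

theory Defs
  imports "Jordan_Normal_Form.Schur_Decomposition"
begin

text \<open>A finite-dimensional complex Hilbert space is given in coordinates with respect to an
  orthonormal basis: it is the space of vectors of dimension \<open>n\<close>, and its operator algebra is
  \<open>carrier_mat n n\<close>. Maps between operator algebras are HOL functions on matrices, of which only
  the values on the carrier matter. The dimension may be \<open>0\<close>.\<close>

definition mat_trace :: "complex mat \<Rightarrow> complex" where
  "mat_trace A = (\<Sum>i<dim_row A. A $$ (i, i))"

text \<open>The order on the complex numbers is the one of \<open>HOL-Library.Complex_Order\<close>: \<open>0 \<le> z\<close> says that
  \<open>z\<close> is real and nonnegative.\<close>

definition psd_mat :: "nat \<Rightarrow> complex mat \<Rightarrow> bool" where
  "psd_mat n A \<longleftrightarrow> A \<in> carrier_mat n n \<and> (\<forall>v \<in> carrier_vec n. 0 \<le> (A *\<^sub>v v) \<bullet>c v)"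


section \<open>Quantum channels\<close>

definition linear_superop :: "nat \<Rightarrow> nat \<Rightarrow> (complex mat \<Rightarrow> complex mat) \<Rightarrow> bool" where
  "linear_superop n m \<Phi> \<longleftrightarrow>
     (\<forall>X \<in> carrier_mat n n. \<Phi> X \<in> carrier_mat m m) \<and>
     (\<forall>X \<in> carrier_mat n n. \<forall>Y \<in> carrier_mat n n. \<Phi> (X + Y) = \<Phi> X + \<Phi> Y) \<and>
     (\<forall>c. \<forall>X \<in> carrier_mat n n. \<Phi> (c \<cdot>\<^sub>m X) = c \<cdot>\<^sub>m \<Phi> X)"

definition positive_superop :: "nat \<Rightarrow> nat \<Rightarrow> (complex mat \<Rightarrow> complex mat) \<Rightarrow> bool" where
  "positive_superop n m \<Phi> \<longleftrightarrow> (\<forall>X. psd_mat n X \<longrightarrow> psd_mat m (\<Phi> X))"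

text \<open>The tensor product of the identity map on the \<open>k\<close> by \<open>k\<close> matrices with \<open>\<Phi>\<close>: a matrix of size
  \<open>k * n\<close> is a \<open>k\<close> by \<open>k\<close> array of blocks of size \<open>n\<close>, and \<open>\<Phi>\<close> is applied to every block.\<close>

definition ampliation ::
  "nat \<Rightarrow> nat \<Rightarrow> nat \<Rightarrow> (complex mat \<Rightarrow> complex mat) \<Rightarrow> complex mat \<Rightarrow> complex mat" where
  "ampliation k n m \<Phi> X = mat (k * m) (k * m) (\<lambda>(i, j).
     \<Phi> (mat n n (\<lambda>(a, b). X $$ ((i div m) * n + a, (j div m) * n + b))) $$ (i mod m, j mod m))"

definition completely_positive :: "nat \<Rightarrow> nat \<Rightarrow> (complex mat \<Rightarrow> complex mat) \<Rightarrow> bool" where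
  "completely_positive n m \<Phi> \<longleftrightarrow>
     (\<forall>k. positive_superop (k * n) (k * m) (ampliation k n m \<Phi>))"

definition trace_preserving :: "nat \<Rightarrow> (complex mat \<Rightarrow> complex mat) \<Rightarrow> bool" where
  "trace_preserving n \<Phi> \<longleftrightarrow> (\<forall>X \<in> carrier_mat n n. mat_trace (\<Phi> X) = mat_trace X)"

definition quantum_channel :: "nat \<Rightarrow> nat \<Rightarrow> (complex mat \<Rightarrow> complex mat) \<Rightarrow> bool" where
  "quantum_channel n m \<Phi> \<longleftrightarrow>
     linear_superop n m \<Phi> \<and> completely_positive n m \<Phi> \<and> trace_preserving n \<Phi>"

text \<open>For linear \<open>\<Phi>\<close> the adjoint exists and is unique; see \<open>superop_adjoint\<close> below.\<close>

definition superop_adjoint ::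
  "nat \<Rightarrow> nat \<Rightarrow> (complex mat \<Rightarrow> complex mat) \<Rightarrow> complex mat \<Rightarrow> complex mat" where
  "superop_adjoint n m \<Phi> Y = (THE Z. Z \<in> carrier_mat n n \<and>
     (\<forall>X \<in> carrier_mat n n. mat_trace (Y * \<Phi> X) = mat_trace (Z * X)))"

lemma mat_trace_mult:
  assumes "A \<in> carrier_mat n m" "B \<in> carrier_mat m n"
  shows "mat_trace (A * B) = (\<Sum>i<n. \<Sum>j<m. A $$ (i, j) * B $$ (j, i))"
  using assms unfolding mat_trace_def
  by (auto simp: scalar_prod_def lessThan_atLeast0 intro!: sum.cong)

lemma superop_adjoint_ex1:
  assumes lin: "linear_superop n m \<Phi>" and Y: "Y \<in> carrier_mat m m"
  shows "\<exists>!Z. Z \<in> carrier_mat n n \<and>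
     (\<forall>X \<in> carrier_mat n n. mat_trace (Y * \<Phi> X) = mat_trace (Z * X))"
proof -
  define U where "U = (\<lambda>(i, j). mat n n (\<lambda>q. if q = (i, j) then 1 else 0 :: complex))"
  have U: "U p \<in> carrier_mat n n" for p
    by (auto simp: U_def split: prod.splits)
  have car: "\<Phi> X \<in> carrier_mat m m" if "X \<in> carrier_mat n n" for X
    using lin that by (auto simp: linear_superop_def)
  define f where "f X = mat_trace (Y * \<Phi> X)" for X
  have f_add: "f (A + B) = f A + f B" if "A \<in> carrier_mat n n" "B \<in> carrier_mat n n" for A B
  proof -
    have "\<Phi> (A + B) = \<Phi> A + \<Phi> B" using lin that by (auto simp: linear_superop_def)
    then show ?thesis
      using car[OF that(1)] car[OF that(2)] Y
      by (simp add: f_def mat_trace_mult[of _ m m] distrib_left sum.distrib)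
  qed
  have f_smult: "f (c \<cdot>\<^sub>m A) = c * f A" if "A \<in> carrier_mat n n" for c A
  proof -
    have "\<Phi> (c \<cdot>\<^sub>m A) = c \<cdot>\<^sub>m \<Phi> A" using lin that by (auto simp: linear_superop_def)
    then show ?thesis
      using car[OF that] Y
      by (simp add: f_def mat_trace_mult[of _ m m] mult.left_commute sum_distrib_left)
  qed
  have f_restrict: "f (mat n n (\<lambda>p. if p \<in> S then X $$ p else 0)) = (\<Sum>p\<in>S. X $$ p * f (U p))"
    if "finite S" "X \<in> carrier_mat n n" for S X
    using that(1)
  proof (induction S)
    case empty
    have "mat n n (\<lambda>p. if p \<in> {} then X $$ p else 0) = 0 \<cdot>\<^sub>m mat n n (\<lambda>p. 0)"
      by (intro eq_matI) auto
    then show ?case using f_smult[of "mat n n (\<lambda>p. 0)" 0] by simp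
  next
    case (insert q S)
    have "mat n n (\<lambda>p. if p \<in> insert q S then X $$ p else 0)
      = X $$ q \<cdot>\<^sub>m U q + mat n n (\<lambda>p. if p \<in> S then X $$ p else 0)"
      using insert(2) by (intro eq_matI) (auto simp: U_def split: prod.splits)
    then show ?case
      using insert U[of q] f_smult[of "U q" "X $$ q"]
      by (simp add: f_add[of "X $$ q \<cdot>\<^sub>m U q"])
  qed
  have f_expand: "f X = (\<Sum>i<n. \<Sum>j<n. X $$ (j, i) * f (U (j, i)))" if X: "X \<in> carrier_mat n n" for X
  proof -
    have "X = mat n n (\<lambda>p. if p \<in> {..<n} \<times> {..<n} then X $$ p else 0)"
      using X by (intro eq_matI) auto
    then have "f X = (\<Sum>p\<in>{..<n} \<times> {..<n}. X $$ p * f (U p))"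
      using f_restrict[of "{..<n} \<times> {..<n}" X] X by simp
    also have "\<dots> = (\<Sum>j<n. \<Sum>i<n. X $$ (j, i) * f (U (j, i)))"
      by (simp add: sum.cartesian_product case_prod_beta)
    also have "\<dots> = (\<Sum>i<n. \<Sum>j<n. X $$ (j, i) * f (U (j, i)))"
      by (rule sum.swap)
    finally show ?thesis .
  qed
  have tr_U: "mat_trace (Z * U (j, i)) = Z $$ (i, j)"
    if "Z \<in> carrier_mat n n" "i < n" "j < n" for Z i j
  proof -
    have "mat_trace (Z * U (j, i)) = (\<Sum>a<n. \<Sum>b<n. if a = i then (if b = j then Z $$ (a, b) else 0) else 0)"
      unfolding mat_trace_mult[OF that(1) U]
      by (intro sum.cong refl) (auto simp: U_def)
    also have "\<dots> = (\<Sum>a<n. if a = i then (\<Sum>b<n. if b = j then Z $$ (a, b) else 0) else 0)"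
      by (intro sum.cong refl) auto
    also have "\<dots> = Z $$ (i, j)" using that by simp
    finally show ?thesis .
  qed
  show ?thesis
  proof (rule ex1I[of _ "mat n n (\<lambda>(i, j). f (U (j, i)))"], intro conjI ballI)
    fix X :: "complex mat" assume X: "X \<in> carrier_mat n n"
    show "mat_trace (Y * \<Phi> X) = mat_trace (mat n n (\<lambda>(i, j). f (U (j, i))) * X)"
      using f_expand[OF X]
      by (subst mat_trace_mult[OF _ X]) (auto simp: f_def mult.commute)
  next
    fix Z assume Z: "Z \<in> carrier_mat n n \<and>
      (\<forall>X \<in> carrier_mat n n. mat_trace (Y * \<Phi> X) = mat_trace (Z * X))"
    then show "Z = mat n n (\<lambda>(i, j). f (U (j, i)))"
      using tr_U U by (intro eq_matI) (auto simp: f_def)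
  qed simp
qed

lemma superop_adjoint:
  assumes "linear_superop n m \<Phi>" and "Y \<in> carrier_mat m m"
  shows "superop_adjoint n m \<Phi> Y \<in> carrier_mat n n"
    and "X \<in> carrier_mat n n \<Longrightarrow>
      mat_trace (Y * \<Phi> X) = mat_trace (superop_adjoint n m \<Phi> Y * X)"
  using theI'[OF superop_adjoint_ex1[OF assms]] by (auto simp: superop_adjoint_def)


section \<open>Correctability and transmittability\<close>

text \<open>A nonzero *-subalgebra of an operator algebra, possibly with a unit other than the identity.
  Every finite-dimensional C*-algebra is isomorphic to one of these.\<close>

definition star_subalgebra :: "nat \<Rightarrow> complex mat set \<Rightarrow> bool" where
  "star_subalgebra n A \<longleftrightarrow>
     A \<subseteq> carrier_mat n n \<and> 0\<^sub>m n n \<in> A \<and> A \<noteq> {0\<^sub>m n n} \<and>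
     (\<forall>X \<in> A. \<forall>Y \<in> A. X + Y \<in> A \<and> X * Y \<in> A) \<and>
     (\<forall>c. \<forall>X \<in> A. c \<cdot>\<^sub>m X \<in> A) \<and>
     (\<forall>X \<in> A. mat_adjoint X \<in> A)"

definition is_unit_of :: "complex mat set \<Rightarrow> complex mat \<Rightarrow> bool" where
  "is_unit_of A P \<longleftrightarrow> P \<in> A \<and> (\<forall>X \<in> A. P * X = X \<and> X * P = X)"

text \<open>\<open>V\<close> is the matrix of the inclusion of the range of the projection \<open>P\<close>, where the range is
  identified with the space of vectors of dimension \<open>r\<close> by the choice of an orthonormal basis (the
  columns of \<open>V\<close>). Two choices differ by a unitary change of coordinates.\<close>

definition is_range_inclusion :: "nat \<Rightarrow> complex mat \<Rightarrow> nat \<Rightarrow> complex mat \<Rightarrow> bool" where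
  "is_range_inclusion n P r V \<longleftrightarrow>
     V \<in> carrier_mat n r \<and> mat_adjoint V * V = 1\<^sub>m r \<and> V * mat_adjoint V = P"

definition restrict_superop ::
  "complex mat \<Rightarrow> (complex mat \<Rightarrow> complex mat) \<Rightarrow> complex mat \<Rightarrow> complex mat" where
  "restrict_superop V \<Phi> Y = \<Phi> (V * Y * mat_adjoint V)"

definition correctable ::
  "nat \<Rightarrow> nat \<Rightarrow> (complex mat \<Rightarrow> complex mat) \<Rightarrow> complex mat set \<Rightarrow> bool" where
  "correctable n m \<Phi> A \<longleftrightarrow> star_subalgebra n A \<and>
     (\<exists>P r V D. is_unit_of A P \<and> is_range_inclusion n P r V \<and> quantum_channel m r D \<and>
        (\<forall>X \<in> (\<lambda>B. mat_adjoint V * B * V) ` A.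
           superop_adjoint r r (D \<circ> restrict_superop V \<Phi>) X = X))"

definition star_hom_on ::
  "nat \<Rightarrow> complex mat set \<Rightarrow> (complex mat \<Rightarrow> complex mat) \<Rightarrow> bool" where
  "star_hom_on n A \<pi> \<longleftrightarrow>
     (\<forall>X \<in> A. \<pi> X \<in> carrier_mat n n) \<and>
     (\<forall>X \<in> A. \<forall>Y \<in> A. \<pi> (X + Y) = \<pi> X + \<pi> Y \<and> \<pi> (X * Y) = \<pi> X * \<pi> Y) \<and>
     (\<forall>c. \<forall>X \<in> A. \<pi> (c \<cdot>\<^sub>m X) = c \<cdot>\<^sub>m \<pi> X) \<and>
     (\<forall>X \<in> A. \<pi> (mat_adjoint X) = mat_adjoint (\<pi> X))"

text \<open>The C*-algebra \<open>A\<close> is given as a *-subalgebra of the matrices of size \<open>l\<close>.\<close>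

definition transmittable ::
  "nat \<Rightarrow> complex mat set \<Rightarrow> nat \<Rightarrow> nat \<Rightarrow> (complex mat \<Rightarrow> complex mat) \<Rightarrow> bool" where
  "transmittable l A n m \<Phi> \<longleftrightarrow> star_subalgebra l A \<and>
     (\<exists>\<pi>. star_hom_on n A \<pi> \<and> inj_on \<pi> A \<and> correctable n m \<Phi> (\<pi> ` A))"


section \<open>Block-diagonal algebras and conditional expectations\<close>

definition block_diag_algebra :: "nat list \<Rightarrow> complex mat set" where
  "block_diag_algebra ds =
     {diag_block_mat Bs | Bs. list_all2 (\<lambda>d B. B \<in> carrier_mat d d) ds Bs}"

definition block_proj :: "nat list \<Rightarrow> nat \<Rightarrow> complex mat" where
  "block_proj ds k = diag_block_mat
     (map (\<lambda>i. if i = k then 1\<^sub>m (ds ! i) else 0\<^sub>m (ds ! i) (ds ! i)) [0..<length ds])"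

text \<open>The type of matrices of all sizes has no zero, so the sum over \<open>k\<close> is written as a fold.\<close>

definition pinching :: "nat list \<Rightarrow> complex mat \<Rightarrow> complex mat" where
  "pinching ds X = foldr (+) (map (\<lambda>k. block_proj ds k * X * block_proj ds k) [0..<length ds])
     (0\<^sub>m (sum_list ds) (sum_list ds))"

definition conditional_expectation ::
  "nat \<Rightarrow> complex mat set \<Rightarrow> (complex mat \<Rightarrow> complex mat) \<Rightarrow> bool" where
  "conditional_expectation l A F \<longleftrightarrow>
     linear_superop l l F \<and> positive_superop l l F \<and>
     (\<forall>X \<in> carrier_mat l l. F X \<in> A) \<and> (\<forall>X \<in> A. F X = X) \<and>
     (\<forall>X \<in> A. \<forall>Y \<in> A. \<forall>Z \<in> carrier_mat l l. F (X * Z * Y) = X * F Z * Y)"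

end

theory Submission
  imports Defs
begin

text \<open>If \<open>\<pi>\<close> embeds the algebra with correctable image, choose for each block a unit vector in the range
  of the image of a minimal projection. Moving it around with the images of the matrix units gives an
  isometry \<open>W\<close> with \<open>W\<^sup>* \<pi>(a) W = a\<close>; encode by \<open>X \<mapsto> W X W\<^sup>*\<close> and decode by the
  correcting channel followed by the adjoint of \<open>\<pi> \<circ> \<P>\<close>, where \<open>\<P>\<close> is the pinching. This avoids the structure
  theory of representations.

  Conversely, let \<open>E\<^sub>a\<close> and \<open>M\<^sub>b\<close> be Kraus operators of the encoder and of \<open>\<D> \<circ> \<Phi>\<close>. Since
  \<open>\<D> \<circ> \<Phi> \<circ> \<E>\<close> is the pinching, each \<open>M\<^sub>b E\<^sub>a\<close> is a combination of the \<open>P\<^sub>k\<close>. Hence \<open>E\<^sub>a P\<^sub>k\<close> is a multiple of an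
  isometry, and the ranges for different \<open>k\<close> are orthogonal. Choosing a nonzero one for each \<open>k\<close> and
  normalising gives an isometry \<open>W\<close> such that all \<open>M\<^sub>b W\<close> are in the centre of the algebra, so \<open>\<D>\<close> itself
  corrects the image of \<open>a \<mapsto> W a W\<^sup>*\<close>.\<close>


section \<open>Matrix entries\<close>

lemma mat_mult_entry:
  assumes "A \<in> carrier_mat n m" "B \<in> carrier_mat m p" "i < n" "j < p"
  shows "(A * B) $$ (i, j) = (\<Sum>k<m. A $$ (i, k) * B $$ (k, j))"
  using assms by (auto simp: scalar_prod_def lessThan_atLeast0)

lemma dim_mat_adjoint [simp]:
  "dim_row (mat_adjoint A) = dim_col A" "dim_col (mat_adjoint A) = dim_row A"
  unfolding mat_adjoint_def by auto

lemma mat_adjoint_carrier [simp]: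
  "A \<in> carrier_mat n m \<Longrightarrow> mat_adjoint A \<in> carrier_mat m n"
  by auto

lemma mat_adjoint_entry [simp]:
  fixes A :: "complex mat"
  assumes "i < dim_col A" "j < dim_row A"
  shows "mat_adjoint A $$ (i, j) = cnj (A $$ (j, i))"
  using assms unfolding mat_adjoint_def by (auto simp: mat_of_rows_def)

lemma mat_adjoint_mult:
  fixes A B :: "complex mat"
  assumes "A \<in> carrier_mat n m" "B \<in> carrier_mat m p"
  shows "mat_adjoint (A * B) = mat_adjoint B * mat_adjoint A"
  using assms by (intro eq_matI) (auto simp: scalar_prod_def mult.commute intro!: sum.cong)

lemma mat_adjoint_adjoint [simp]: "mat_adjoint (mat_adjoint A) = (A :: complex mat)"
  by (intro eq_matI) auto

lemma mat_trace_comm: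
  assumes "A \<in> carrier_mat n m" "B \<in> carrier_mat m n"
  shows "mat_trace (A * B) = mat_trace (B * A)"
  unfolding mat_trace_mult[OF assms] mat_trace_mult[OF assms(2,1)]
  by (subst sum.swap) (simp add: mult.commute)

section \<open>Matrix units and their action on entries\<close>

definition unit_mat :: "nat \<Rightarrow> nat \<Rightarrow> nat \<Rightarrow> complex mat" where
  "unit_mat n i j = mat n n (\<lambda>p. if p = (i, j) then 1 else 0)"

lemma unit_mat_carrier [simp]: "unit_mat n i j \<in> carrier_mat n n"
  by (simp add: unit_mat_def)

lemma dim_unit_mat [simp]: "dim_row (unit_mat n i j) = n" "dim_col (unit_mat n i j) = n"
  by (simp_all add: unit_mat_def)

lemma unit_mat_entry [simp]:
  "p < n \<Longrightarrow> q < n \<Longrightarrow> unit_mat n i j $$ (p, q) = (if p = i \<and> q = j then 1 else 0)"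
  by (simp add: unit_mat_def)

lemma mat_adjoint_unit [simp]: "mat_adjoint (unit_mat n i j) = unit_mat n j i"
  by (intro eq_matI) auto

lemma unit_mat_mult_entry:
  assumes "A \<in> carrier_mat n m" "j < n" "p < n" "q < m"
  shows "(unit_mat n i j * A) $$ (p, q) = (if p = i then A $$ (j, q) else 0)"
proof -
  have "(unit_mat n i j * A) $$ (p, q) = (\<Sum>k<n. if k = j then (if p = i then A $$ (j, q) else 0) else 0)"
    unfolding mat_mult_entry[OF unit_mat_carrier assms(1,3,4)]
    using assms(3) by (intro sum.cong) auto
  then show ?thesis using assms(2) by simp
qed

lemma mult_unit_mat_entry:
  assumes "A \<in> carrier_mat m n" "i < n" "p < m" "q < n"
  shows "(A * unit_mat n i j) $$ (p, q) = (if q = j then A $$ (p, i) else 0)"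
proof -
  have "(A * unit_mat n i j) $$ (p, q) = (\<Sum>k<n. if k = i then (if q = j then A $$ (p, i) else 0) else 0)"
    unfolding mat_mult_entry[OF assms(1) unit_mat_carrier assms(3,4)]
    using assms(4) by (intro sum.cong) auto
  then show ?thesis using assms(2) by simp
qed

lemma unit_mat_mult_unit_mat:
  assumes "j < n"
  shows "unit_mat n i j * unit_mat n h k = (if j = h then unit_mat n i k else 0\<^sub>m n n)"
  using assms by (intro eq_matI)
    (auto simp: unit_mat_mult_entry[OF unit_mat_carrier] simp del: index_mult_mat(1))

text \<open>Matrix units on both sides isolate one entry. Under a homomorphism this recovers the
  entries of \<open>a\<close> from the image of \<open>a\<close>.\<close>

lemma unit_mat_sandwich:
  assumes A: "A \<in> carrier_mat n n" and ij: "i < n" "j < n"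
  shows "unit_mat n h i * A * unit_mat n j k = A $$ (i, j) \<cdot>\<^sub>m unit_mat n h k"
proof -
  have c: "unit_mat n h i * A \<in> carrier_mat n n" by (rule mult_carrier_mat[OF unit_mat_carrier A])
  show ?thesis
    using ij A by (intro eq_matI)
      (auto simp: mult_unit_mat_entry[OF c] unit_mat_mult_entry[OF A] simp del: index_mult_mat(1))
qed

text \<open>Reduces an identity between entries to one between traces; note the transposed
  indices.\<close>

lemma mat_trace_unit:
  assumes A: "A \<in> carrier_mat n n" and ij: "i < n" "j < n"
  shows "mat_trace (unit_mat n j i * A) = A $$ (i, j)"
proof -
  have "mat_trace (unit_mat n j i * A) = (\<Sum>p<n. if p = j then A $$ (i, p) else 0)"
    using ij unfolding mat_trace_def
    by (intro sum.cong) (auto simp: unit_mat_mult_entry[OF A] simp del: index_mult_mat(1))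
  then show ?thesis using ij by simp
qed

lemma mat_mult3_entry:
  assumes "A \<in> carrier_mat n m" "B \<in> carrier_mat m p" "C \<in> carrier_mat p q" "i < n" "j < q"
  shows "(A * B * C) $$ (i, j) = (\<Sum>a<m. \<Sum>b<p. A $$ (i, a) * B $$ (a, b) * C $$ (b, j))"
proof -
  have "(A * B * C) $$ (i, j) = (\<Sum>b<p. \<Sum>a<m. A $$ (i, a) * B $$ (a, b) * C $$ (b, j))"
    using assms
    by (subst mat_mult_entry[of _ n p _ q])
      (auto simp: mat_mult_entry[OF assms(1,2)] sum_distrib_right simp del: index_mult_mat(1))
  then show ?thesis by (subst sum.swap)
qed

lemma mat_mult_assoc:
  fixes A B C :: "complex mat"
  shows "dim_col A = dim_row B \<Longrightarrow> dim_col B = dim_row C \<Longrightarrow> A * B * C = A * (B * C)"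
  by (rule assoc_mult_mat) auto

lemma mat_mult_adjoint_entry:
  fixes W X :: "complex mat"
  assumes W: "W \<in> carrier_mat m n" and X: "X \<in> carrier_mat n n" and "p < m" "q < m"
  shows "(W * X * mat_adjoint W) $$ (p, q) = (\<Sum>i<n. \<Sum>j<n. W $$ (p, i) * X $$ (i, j) * cnj (W $$ (q, j)))"
proof -
  have "(W * X * mat_adjoint W) $$ (p, q) = (\<Sum>j<n. \<Sum>i<n. W $$ (p, i) * X $$ (i, j) * cnj (W $$ (q, j)))"
    using assms
    by (subst mat_mult_entry[of _ m n _ m])
      (auto simp: mat_mult_entry[OF W X] sum_distrib_right simp del: index_mult_mat(1))
  then show ?thesis by (subst sum.swap)
qed

text \<open>Membership of \<open>X\<close> in \<open>A\<close> is carried through the induction on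
  the support \<open>T\<close>, because \<open>f\<close> is linear only on \<open>A\<close>. In one
  use \<open>A\<close> consists of all matrices, in the other it is the block-diagonal algebra and
  \<open>T\<close> is the diagonal.\<close>

lemma linear_expand:
  fixes f :: "complex mat \<Rightarrow> complex"
  assumes A: "A \<subseteq> carrier_mat n n" "0\<^sub>m n n \<in> A"
      "\<And>X Y. X \<in> A \<Longrightarrow> Y \<in> A \<Longrightarrow> X + Y \<in> A" "\<And>c X. X \<in> A \<Longrightarrow> c \<cdot>\<^sub>m X \<in> A"
    and f: "\<And>X Y. X \<in> A \<Longrightarrow> Y \<in> A \<Longrightarrow> f (X + Y) = f X + f Y"
      "\<And>c X. X \<in> A \<Longrightarrow> f (c \<cdot>\<^sub>m X) = c * f X"
    and T: "finite T" "\<And>i j. (i, j) \<in> T \<Longrightarrow> i < n \<and> j < n \<and> unit_mat n i j \<in> A"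
    and X: "X \<in> carrier_mat n n" "\<And>i j. i < n \<Longrightarrow> j < n \<Longrightarrow> (i, j) \<notin> T \<Longrightarrow> X $$ (i, j) = 0"
  shows "f X = (\<Sum>(i, j)\<in>T. X $$ (i, j) * f (unit_mat n i j))"
proof -
  have "X \<in> A \<and> f X = (\<Sum>(i, j)\<in>T. X $$ (i, j) * f (unit_mat n i j))"
    using T X
  proof (induction T arbitrary: X)
    case empty
    then have X0: "X = 0\<^sub>m n n" by (intro eq_matI) auto
    have "0 \<cdot>\<^sub>m 0\<^sub>m n n = (0\<^sub>m n n :: complex mat)" by (intro eq_matI) auto
    then have "f (0\<^sub>m n n) = 0" using f(2)[OF A(2), of 0] by simp
    then show ?case using A(2) X0 by simp
  next
    case (insert t T)
    obtain i j where t: "t = (i, j)" by fastforce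
    \<comment> \<open>Clearing the entry at \<open>t\<close> leaves a matrix supported in
      \<open>T\<close>.\<close>
    define Y where "Y = mat n n (\<lambda>q. if q = (i, j) then 0 else X $$ q)"
    have ij: "i < n" "j < n" "unit_mat n i j \<in> A" using insert.prems(1) t by auto
    have Y: "Y \<in> A \<and> f Y = (\<Sum>(i, j)\<in>T. Y $$ (i, j) * f (unit_mat n i j))"
      using insert.prems t by (intro insert.IH) (auto simp: Y_def)
    have sum: "(\<Sum>(i, j)\<in>T. Y $$ (i, j) * f (unit_mat n i j)) =
        (\<Sum>(i, j)\<in>T. X $$ (i, j) * f (unit_mat n i j))"
    proof (intro sum.cong refl, clarify)
      fix a b assume ab: "(a, b) \<in> T"
      then have "a < n" "b < n" "(a, b) \<noteq> (i, j)" using insert.hyps insert.prems(1) t by auto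
      then show "Y $$ (a, b) * f (unit_mat n a b) = X $$ (a, b) * f (unit_mat n a b)"
        by (auto simp: Y_def)
    qed
    have X: "X = X $$ (i, j) \<cdot>\<^sub>m unit_mat n i j + Y"
      using insert.prems(2) by (intro eq_matI) (auto simp: Y_def)
    have in_A: "X $$ (i, j) \<cdot>\<^sub>m unit_mat n i j \<in> A" using A ij by simp
    have "f X = X $$ (i, j) * f (unit_mat n i j) + f Y"
      by (subst X, subst f(1)[OF in_A], use Y f(2)[OF ij(3)] in simp_all)
    moreover have "X \<in> A" using A(3)[OF in_A conjunct1[OF Y]] X by simp
    ultimately show ?case using insert.hyps Y sum by (simp add: t)
  qed
  then show ?thesis ..
qed

lemma linear_superop_expand:
  assumes lin: "linear_superop n m \<Phi>" and X: "X \<in> carrier_mat n n" and pq: "p < m" "q < m"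
  shows "\<Phi> X $$ (p, q) = (\<Sum>i<n. \<Sum>j<n. X $$ (i, j) * \<Phi> (unit_mat n i j) $$ (p, q))"
proof -
  have car: "\<Phi> Y \<in> carrier_mat m m" if "Y \<in> carrier_mat n n" for Y
    using lin that by (auto simp: linear_superop_def)
  have "\<Phi> X $$ (p, q) = (\<Sum>(i, j)\<in>{..<n} \<times> {..<n}. X $$ (i, j) * \<Phi> (unit_mat n i j) $$ (p, q))"
    using lin X pq carrier_matD[OF car]
    by (intro linear_expand[of "carrier_mat n n" n "\<lambda>X. \<Phi> X $$ (p, q)"])
      (auto simp: linear_superop_def)
  then show ?thesis by (simp add: sum.cartesian_product)
qed

lemma linear_superop_comp:
  assumes "linear_superop n m \<Phi>" "linear_superop m k \<Psi>"
  shows "linear_superop n k (\<Psi> \<circ> \<Phi>)"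
  using assms unfolding linear_superop_def by auto

text \<open>An index below \<open>k * m\<close> encodes a block number and a position in the block,
  as in \<open>ampliation\<close>.\<close>

lemma div_mod_bound:
  fixes I :: nat
  assumes "I < k * m"
  shows "I div m < k" "I mod m < m"
proof -
  have "0 < m" using assms by (cases m) auto
  then show "I div m < k" "I mod m < m" using assms by (auto simp: less_mult_imp_div_less)
qed

lemma mult_add_bound:
  fixes a :: nat
  assumes "a < k" "p < m"
  shows "a * m + p < k * m"
proof -
  have "a * m + p < a * m + m" using assms(2) by simp
  also have "\<dots> = Suc a * m" by simp
  also have "\<dots> \<le> k * m" using assms(1) by (intro mult_le_mono1) simp
  finally show ?thesis .
qed

lemma conj_linear:
  fixes V :: "complex mat"
  assumes V: "V \<in> carrier_mat n r"
  shows "linear_superop r n (\<lambda>Y. V * Y * mat_adjoint V)"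
  unfolding linear_superop_def
proof (intro conjI ballI allI)
  fix X Y :: "complex mat" and c
  assume X: "X \<in> carrier_mat r r"
  note VX = mult_carrier_mat[OF V X] and V' = mat_adjoint_carrier[OF V]
  show "V * X * mat_adjoint V \<in> carrier_mat n n" by (rule mult_carrier_mat[OF VX V'])
  show "V * (c \<cdot>\<^sub>m X) * mat_adjoint V = c \<cdot>\<^sub>m (V * X * mat_adjoint V)"
    by (simp only: mult_smult_distrib[OF V X] mult_smult_assoc_mat[OF VX V'])
  assume Y: "Y \<in> carrier_mat r r"
  show "V * (X + Y) * mat_adjoint V = V * X * mat_adjoint V + V * Y * mat_adjoint V"
    by (simp only: mult_add_distrib_mat[OF V X Y]
        add_mult_distrib_mat[OF VX mult_carrier_mat[OF V Y] V'])
qed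


section \<open>Positive semidefinite matrices\<close>

text \<open>The entries are given by a function rather than a matrix, so that an induction on
  \<open>n\<close> can pass to the leading part without cutting matrices down.\<close>

definition quad_form :: "nat \<Rightarrow> (nat \<Rightarrow> nat \<Rightarrow> complex) \<Rightarrow> (nat \<Rightarrow> complex) \<Rightarrow> complex" where
  "quad_form n A f = (\<Sum>i<n. \<Sum>j<n. cnj (f i) * A i j * f j)"

lemma quad_form_vec:
  assumes "A \<in> carrier_mat n n" "v \<in> carrier_vec n"
  shows "(A *\<^sub>v v) \<bullet>c v = quad_form n (\<lambda>i j. A $$ (i, j)) (($) v)"
  using assms
  by (simp add: quad_form_def scalar_prod_def lessThan_atLeast0 sum_distrib_left
      sum_distrib_right mult_ac)

lemma psd_mat_quad_form:
  assumes "A \<in> carrier_mat n n"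
  shows "psd_mat n A \<longleftrightarrow> (\<forall>f. 0 \<le> quad_form n (\<lambda>i j. A $$ (i, j)) f)"
proof
  assume psd: "psd_mat n A"
  show "\<forall>f. 0 \<le> quad_form n (\<lambda>i j. A $$ (i, j)) f"
  proof
    fix f
    have "quad_form n (\<lambda>i j. A $$ (i, j)) f = quad_form n (\<lambda>i j. A $$ (i, j)) (($) (vec n f))"
      by (simp add: quad_form_def)
    then show "0 \<le> quad_form n (\<lambda>i j. A $$ (i, j)) f"
      using psd by (simp add: psd_mat_def quad_form_vec[OF assms, symmetric])
  qed
qed (simp add: psd_mat_def assms quad_form_vec[OF assms])

lemma quad_form_Suc:
  "quad_form (Suc n) A f = quad_form n A f + (\<Sum>i<n. cnj (f i) * A i n) * f n
     + cnj (f n) * (\<Sum>j<n. A n j * f j) + cnj (f n) * A n n * f n"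
  by (simp add: quad_form_def sum.distrib sum_distrib_left sum_distrib_right mult_ac add_ac)

lemma quad_form_two:
  assumes "i < n" "j < n" "i \<noteq> j"
  shows "quad_form n A (\<lambda>x. if x = i then a else if x = j then b else 0) =
    cnj a * A i i * a + cnj a * A i j * b + cnj b * A j i * a + cnj b * A j j * b"
proof -
  let ?f = "\<lambda>x. if x = i then a else if x = j then b else 0"
  have *: "(\<Sum>x<n. g x * ?f x) = g i * a + g j * b" for g
  proof -
    have "(\<Sum>x<n. g x * ?f x) = (\<Sum>x\<in>{i, j}. g x * ?f x)"
      using assms by (intro sum.mono_neutral_right) auto
    then show ?thesis using assms(3) by simp
  qed
  have **: "(\<Sum>x<n. cnj (?f x) * g x) = cnj a * g i + cnj b * g j" for g
  proof -
    have "(\<Sum>x<n. cnj (?f x) * g x) = (\<Sum>x\<in>{i, j}. cnj (?f x) * g x)"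
      using assms by (intro sum.mono_neutral_right) auto
    then show ?thesis using assms(3) by simp
  qed
  have "quad_form n A ?f = (\<Sum>x<n. cnj (?f x) * (A x i * a + A x j * b))"
    unfolding quad_form_def
    by (intro sum.cong refl) (subst *[symmetric], simp only: sum_distrib_left mult.assoc)
  also have "\<dots> = cnj a * (A i i * a + A i j * b) + cnj b * (A j i * a + A j j * b)"
    by (rule **)
  finally show ?thesis by (simp add: algebra_simps)
qed

lemma psd_diag_nonneg:
  assumes "\<And>f. 0 \<le> quad_form n A f" "i < n"
  shows "0 \<le> A i i"
proof -
  have "quad_form n A (\<lambda>x. if x = i then 1 else 0)
      = (\<Sum>x<n. \<Sum>y<n. if y = i then if x = i then A i i else 0 else 0)"
    unfolding quad_form_def by (intro sum.cong) auto
  also have "\<dots> = A i i" using assms(2) by simp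
  finally have "quad_form n A (\<lambda>x. if x = i then 1 else 0) = A i i" .
  then show ?thesis using assms(1) by metis
qed

text \<open>Polarisation: the form is real at the test vectors with entry 1 at \<open>i\<close> and
  1 or \<i> at \<open>j\<close>. The first gives the imaginary parts, the second the real
  parts.\<close>

lemma psd_hermitian:
  assumes psd: "\<And>f. 0 \<le> quad_form n A f" and ij: "i < n" "j < n"
  shows "A j i = cnj (A i j)"
proof (cases "i = j")
  case True
  then show ?thesis using psd_diag_nonneg[OF assms(1,2)]
    by (simp add: less_eq_complex_def complex_eq_iff)
next
  case False
  have *: "0 \<le> A i i + A i j * b + cnj b * A j i + cnj b * A j j * b" for b
    using psd[of "\<lambda>x. if x = i then 1 else if x = j then b else 0"]
    unfolding quad_form_two[OF ij False] by simp
  show ?thesis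
    using *[of 1] *[of \<i>] psd_diag_nonneg[OF psd ij(1)] psd_diag_nonneg[OF psd ij(2)]
    by (simp add: less_eq_complex_def complex_eq_iff)
qed

text \<open>With a zero at (\<open>j\<close>, \<open>j\<close>), the form at a vector with entries 1
  at \<open>i\<close> and \<open>- t * cnj (A i j)\<close> at \<open>j\<close> is affine in the real
  parameter \<open>t\<close>, with slope -2 times the squared modulus of \<open>A i j\<close>.
  Nonnegativity for all \<open>t\<close> makes the slope vanish.\<close>

lemma psd_diag_zero:
  assumes psd: "\<And>f. 0 \<le> quad_form n A f" and ij: "i < n" "j < n" and zero: "A j j = 0"
  shows "A i j = 0"
proof (cases "i = j")
  case False
  define r where "r = (Re (A i j))\<^sup>2 + (Im (A i j))\<^sup>2"
  have *: "0 \<le> Re (A i i) - 2 * t * r" for t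
  proof -
    have "0 \<le> A i i - 2 * of_real t * (A i j * cnj (A i j))"
      using psd[of "\<lambda>x. if x = i then 1 else if x = j then - of_real t * cnj (A i j) else 0"]
      unfolding quad_form_two[OF ij False] psd_hermitian[OF psd ij] zero
      by (simp add: mult_ac)
    then show ?thesis
      by (simp add: less_eq_complex_def complex_mult_cnj r_def)
  qed
  have "r = 0"
  proof (rule ccontr)
    assume "r \<noteq> 0"
    \<comment> \<open>This \<open>t\<close> makes the form equal to -1.\<close>
    then show False using *[of "(Re (A i i) + 1) / (2 * r)"] by simp
  qed
  then show ?thesis by (simp add: r_def complex_eq_iff sum_power2_eq_zero_iff)
qed (use zero in simp)

text \<open>Cholesky elimination of the last index. When the pivot \<open>A n n\<close> vanishes, so does its whole
  column, and division by zero gives the right value.\<close>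

lemma psd_factorization:
  assumes "\<And>f. 0 \<le> quad_form n A f"
  shows "\<exists>v. \<forall>i<n. \<forall>j<n. A i j = (\<Sum>c<n. v c i * cnj (v c j))"
  using assms
proof (induction n arbitrary: A)
  case (Suc n)
  define d where "d = A n n"
  have d0: "0 \<le> d" unfolding d_def using psd_diag_nonneg[OF Suc.prems] by simp
  have herm: "A j i = cnj (A i j)" if "i \<le> n" "j \<le> n" for i j
    using psd_hermitian[OF Suc.prems, of i j] that by simp
  have col0: "A i n = 0" if "d = 0" "i \<le> n" for i
    using psd_diag_zero[OF Suc.prems, of i n] that by (simp add: d_def)
  \<comment> \<open>The Schur complement of the pivot.\<close>
  define B where "B i j = A i j - A i n * A n j / d" for i j
  have "0 \<le> quad_form n B f" for f
  proof -
    define s where "s = (\<Sum>j<n. A n j * f j)"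
    \<comment> \<open>This last coordinate completes the square, so that the form of
      \<open>A\<close> at \<open>f'\<close> is the form of \<open>B\<close> at \<open>f\<close>. If
      \<open>d = 0\<close>, then \<open>s = 0\<close> as well and the identity persists.\<close>
    define f' where "f' = f(n := - s / d)"
    have s': "(\<Sum>i<n. cnj (f i) * A i n) = cnj s"
    proof -
      have "A i n = cnj (A n i)" if "i < n" for i using herm[of n i] that by simp
      then show ?thesis by (simp add: s_def mult.commute)
    qed
    have s0: "s = 0" if "d = 0"
    proof -
      have "A n j = 0" if "j < n" for j
        using col0[OF \<open>d = 0\<close>, of j] herm[of j n] that by simp
      then show ?thesis by (simp add: s_def)
    qed
    have f'n: "quad_form n A f' = quad_form n A f" "(\<Sum>i<n. cnj (f' i) * A i n) = cnj s"
      "(\<Sum>j<n. A n j * f' j) = s"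
      unfolding s'[symmetric] by (simp_all add: quad_form_def f'_def s_def)
    have cd: "cnj d = d" using d0 by (simp add: less_eq_complex_def complex_eq_iff)
    have "quad_form (Suc n) A f' = quad_form n A f - cnj s * s / d"
      unfolding quad_form_Suc f'n d_def[symmetric]
      using s0 by (cases "d = 0") (auto simp: f'_def cd field_simps)
    also have "cnj s * s / d = (\<Sum>i<n. \<Sum>j<n. cnj (f i) * (A i n * A n j / d) * f j)"
      unfolding s'[symmetric] unfolding s_def sum_product sum_divide_distrib
      by (simp add: mult_ac)
    also have "quad_form n A f - \<dots> = quad_form n B f"
      by (simp add: quad_form_def B_def sum_subtractf algebra_simps)
    finally show ?thesis using Suc.prems[of f'] by simp
  qed
  from Suc.IH[OF this] obtain v where
    v: "\<And>i j. i < n \<Longrightarrow> j < n \<Longrightarrow> B i j = (\<Sum>c<n. v c i * cnj (v c j))" by blast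
  define r where "r = complex_of_real (sqrt (Re d))"
  have rr: "r * r = d" "cnj r = r"
    using d0 by (auto simp: r_def less_eq_complex_def complex_eq_iff)
  \<comment> \<open>The new vector is the last column divided by the square root of the pivot; the
    vectors for \<open>B\<close> are extended by 0 at index \<open>n\<close>.\<close>
  define w where "w c i = (if c < n then if i < n then v c i else 0 else A i n / r)" for c i
  have "A i j = (\<Sum>c<Suc n. w c i * cnj (w c j))" if "i < Suc n" "j < Suc n" for i j
  proof -
    have last: "w n i * cnj (w n j) = A i n * A n j / d"
      using herm[of n j] herm[of j n] that by (simp add: w_def rr flip: rr(1))
    show ?thesis
    proof (cases "i < n \<and> j < n")
      case True
      then have "(\<Sum>c<n. w c i * cnj (w c j)) = B i j"
        by (subst v) (auto simp: w_def)
      then show ?thesis by (simp add: last B_def)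
    next
      case False
      then have "i = n \<or> j = n" using that by auto
      then have "A i n * A n j / d = A i j"
        using col0[of i] col0[of j] herm[of j n] that
        by (cases "d = 0") (auto simp: d_def[symmetric] less_Suc_eq_le)
      moreover have "(\<Sum>c<n. w c i * cnj (w c j)) = 0"
        using False by (auto simp: w_def)
      ultimately show ?thesis by (simp add: last)
    qed
  qed
  then show ?case by blast
qed simp


section \<open>Kraus representations\<close>

text \<open>The sum of the \<open>K\<^sub>c X K\<^sub>c\<^sup>*\<close>, with \<open>K c p i\<close>
  the entry in row \<open>p\<close> and column \<open>i\<close>. The index type is left free because
  pairs and the unit type also serve as index sets.\<close>

definition kraus_map ::
  "nat \<Rightarrow> nat \<Rightarrow> 'c set \<Rightarrow> ('c \<Rightarrow> nat \<Rightarrow> nat \<Rightarrow> complex) \<Rightarrow> complex mat \<Rightarrow> complex mat" where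
  "kraus_map n m S K X = mat m m (\<lambda>(p, q).
     \<Sum>c\<in>S. \<Sum>i<n. \<Sum>j<n. K c p i * X $$ (i, j) * cnj (K c q j))"

lemma kraus_map_carrier [simp]: "kraus_map n m S K X \<in> carrier_mat m m"
  by (simp add: kraus_map_def)

lemma kraus_map_entry:
  "p < m \<Longrightarrow> q < m \<Longrightarrow> kraus_map n m S K X $$ (p, q) =
     (\<Sum>c\<in>S. \<Sum>i<n. \<Sum>j<n. K c p i * X $$ (i, j) * cnj (K c q j))"
  by (simp add: kraus_map_def)

lemma kraus_map_linear: "linear_superop n m (kraus_map n m S K)"
  unfolding linear_superop_def
  by (auto intro!: eq_matI simp: kraus_map_def sum.distrib sum_distrib_left algebra_simps)

lemma kraus_map_unit:
  assumes "i < n" "j < n" "p < m" "q < m"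
  shows "kraus_map n m S K (unit_mat n i j) $$ (p, q) = (\<Sum>c\<in>S. K c p i * cnj (K c q j))"
proof -
  have "(\<Sum>a<n. \<Sum>b<n. K c p a * unit_mat n i j $$ (a, b) * cnj (K c q b))
    = (\<Sum>a<n. \<Sum>b<n. if b = j then if a = i then K c p i * cnj (K c q j) else 0 else 0)" for c
    by (intro sum.cong refl) auto
  then show ?thesis using assms by (simp add: kraus_map_entry)
qed

text \<open>The form of a Gram matrix at \<open>f\<close> is the sum of the squared moduli of the
  \<open>z c\<close>.\<close>

lemma gram_psd:
  assumes "\<And>i j. i < n \<Longrightarrow> j < n \<Longrightarrow> A i j = (\<Sum>c\<in>S. y c i * cnj (y c j))"
  shows "0 \<le> quad_form n A f"
proof -
  define z where "z c = (\<Sum>i<n. cnj (f i) * y c i)" for c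
  have "quad_form n A f = (\<Sum>i<n. \<Sum>j<n. \<Sum>c\<in>S. (cnj (f i) * y c i) * cnj (cnj (f j) * y c j))"
    unfolding quad_form_def
    by (intro sum.cong refl) (simp add: assms sum_distrib_left sum_distrib_right mult_ac)
  also have "\<dots> = (\<Sum>i<n. \<Sum>c\<in>S. \<Sum>j<n. (cnj (f i) * y c i) * cnj (cnj (f j) * y c j))"
    by (intro sum.cong refl sum.swap)
  also have "\<dots> = (\<Sum>c\<in>S. \<Sum>i<n. \<Sum>j<n. (cnj (f i) * y c i) * cnj (cnj (f j) * y c j))"
    by (rule sum.swap)
  also have "\<dots> = (\<Sum>c\<in>S. z c * cnj (z c))"
    unfolding z_def cnj_sum sum_product ..
  also have "0 \<le> \<dots>"
    by (intro sum_nonneg) (simp add: less_eq_complex_def complex_mult_cnj)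
  finally show ?thesis .
qed

text \<open>Write \<open>X\<close> as a sum of rank one terms with vectors \<open>x d\<close>. The
  ampliation turns it into the Gram matrix of the vectors \<open>y (c, d)\<close>, obtained by
  applying \<open>K c\<close> to every block of \<open>x d\<close>.\<close>

lemma kraus_map_completely_positive: "completely_positive n m (kraus_map n m S K)"
  unfolding completely_positive_def positive_superop_def
proof (intro allI impI)
  fix k X assume psd: "psd_mat (k * n) X"
  have X: "X \<in> carrier_mat (k * n) (k * n)" using psd by (simp add: psd_mat_def)
  obtain x where x: "\<And>i j. i < k * n \<Longrightarrow> j < k * n \<Longrightarrow>
      X $$ (i, j) = (\<Sum>d<k * n. x d i * cnj (x d j))"
    using psd psd_factorization[of "k * n" "\<lambda>i j. X $$ (i, j)"]
    unfolding psd_mat_quad_form[OF X] by blast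
  define y where "y = (\<lambda>(c, d) I. \<Sum>i<n. K c (I mod m) i * x d (I div m * n + i))"
  let ?Y = "ampliation k n m (kraus_map n m S K) X"
  have "?Y $$ (I, J) = (\<Sum>cd\<in>S \<times> {..<k * n}. y cd I * cnj (y cd J))"
    if I: "I < k * m" and J: "J < k * m" for I J
  proof -
    note b = div_mod_bound[OF I] div_mod_bound[OF J]
    define u where "u c d i = K c (I mod m) i * x d (I div m * n + i)" for c d i
    define v where "v c d j = K c (J mod m) j * x d (J div m * n + j)" for c d j
    have "?Y $$ (I, J) = (\<Sum>c\<in>S. \<Sum>i<n. \<Sum>j<n. K c (I mod m) i *
        X $$ (I div m * n + i, J div m * n + j) * cnj (K c (J mod m) j))"
      using I J b by (simp add: ampliation_def kraus_map_entry)
    also have "\<dots> = (\<Sum>c\<in>S. \<Sum>i<n. \<Sum>j<n. \<Sum>d<k * n. u c d i * cnj (v c d j))"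
    proof (intro sum.cong refl)
      fix c i j assume ij: "i \<in> {..<n}" "j \<in> {..<n}"
      have "X $$ (I div m * n + i, J div m * n + j) =
          (\<Sum>d<k * n. x d (I div m * n + i) * cnj (x d (J div m * n + j)))"
        using ij b by (intro x mult_add_bound) auto
      then show "K c (I mod m) i * X $$ (I div m * n + i, J div m * n + j) * cnj (K c (J mod m) j)
        = (\<Sum>d<k * n. u c d i * cnj (v c d j))"
        by (simp add: u_def v_def sum_distrib_left sum_distrib_right mult_ac)
    qed
    also have "\<dots> = (\<Sum>c\<in>S. \<Sum>i<n. \<Sum>d<k * n. \<Sum>j<n. u c d i * cnj (v c d j))"
      by (intro sum.cong refl sum.swap)
    also have "\<dots> = (\<Sum>c\<in>S. \<Sum>d<k * n. \<Sum>i<n. \<Sum>j<n. u c d i * cnj (v c d j))"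
      by (intro sum.cong refl sum.swap)
    also have "\<dots> = (\<Sum>c\<in>S. \<Sum>d<k * n. (\<Sum>i<n. u c d i) * cnj (\<Sum>j<n. v c d j))"
      by (simp only: sum_product cnj_sum)
    finally show ?thesis by (simp add: sum.cartesian_product y_def u_def v_def case_prod_beta)
  qed
  moreover have "?Y \<in> carrier_mat (k * m) (k * m)" by (simp add: ampliation_def)
  ultimately show "psd_mat (k * m) ?Y"
    unfolding psd_mat_quad_form[OF \<open>?Y \<in> carrier_mat (k * m) (k * m)\<close>]
    using gram_psd[of "k * m" "\<lambda>i j. ?Y $$ (i, j)"] by blast
qed

text \<open>The hypothesis says that the \<open>K\<^sub>c\<^sup>* K\<^sub>c\<close> add up to the
  identity; reordering the sums brings this expression out of the trace.\<close>

lemma kraus_map_trace: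
  assumes tp: "\<And>i j. i < n \<Longrightarrow> j < n \<Longrightarrow>
      (\<Sum>c\<in>S. \<Sum>p<m. cnj (K c p i) * K c p j) = (if i = j then 1 else 0)"
  shows "trace_preserving n (kraus_map n m S K)"
  unfolding trace_preserving_def
proof
  fix X :: "complex mat" assume X: "X \<in> carrier_mat n n"
  have "mat_trace (kraus_map n m S K X) =
      (\<Sum>p<m. \<Sum>c\<in>S. \<Sum>i<n. \<Sum>j<n. X $$ (i, j) * (cnj (K c p j) * K c p i))"
    unfolding mat_trace_def using carrier_matD[OF kraus_map_carrier[of n m S K X]]
    by (simp add: kraus_map_entry mult_ac)
  also have "\<dots> = (\<Sum>c\<in>S. \<Sum>p<m. \<Sum>i<n. \<Sum>j<n. X $$ (i, j) * (cnj (K c p j) * K c p i))"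
    by (rule sum.swap)
  also have "\<dots> = (\<Sum>c\<in>S. \<Sum>i<n. \<Sum>p<m. \<Sum>j<n. X $$ (i, j) * (cnj (K c p j) * K c p i))"
    by (intro sum.cong refl sum.swap)
  also have "\<dots> = (\<Sum>c\<in>S. \<Sum>i<n. \<Sum>j<n. \<Sum>p<m. X $$ (i, j) * (cnj (K c p j) * K c p i))"
    by (intro sum.cong refl sum.swap)
  also have "\<dots> = (\<Sum>i<n. \<Sum>c\<in>S. \<Sum>j<n. \<Sum>p<m. X $$ (i, j) * (cnj (K c p j) * K c p i))"
    by (rule sum.swap)
  also have "\<dots> = (\<Sum>i<n. \<Sum>j<n. \<Sum>c\<in>S. \<Sum>p<m. X $$ (i, j) * (cnj (K c p j) * K c p i))"
    by (intro sum.cong refl sum.swap)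
  also have "\<dots> = (\<Sum>i<n. \<Sum>j<n. X $$ (i, j) * (\<Sum>c\<in>S. \<Sum>p<m. cnj (K c p j) * K c p i))"
    by (simp only: sum_distrib_left)
  also have "\<dots> = (\<Sum>i<n. \<Sum>j<n. if j = i then X $$ (i, i) else 0)"
    by (intro sum.cong refl) (simp add: tp)
  also have "\<dots> = mat_trace X" using X by (simp add: mat_trace_def)
  finally show "mat_trace (kraus_map n m S K X) = mat_trace X" .
qed

lemma kraus_map_channel:
  assumes "\<And>i j. i < n \<Longrightarrow> j < n \<Longrightarrow>
      (\<Sum>c\<in>S. \<Sum>p<m. cnj (K c p i) * K c p j) = (if i = j then 1 else 0)"
  shows "quantum_channel n m (kraus_map n m S K)"
  unfolding quantum_channel_def
  using kraus_map_linear kraus_map_completely_positive kraus_map_trace[OF assms] by blast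

text \<open>Choi's theorem: the Kraus operators come from a factorisation of the image of the
  (unnormalised) maximally entangled state.\<close>

lemma channel_kraus:
  assumes ch: "quantum_channel n m \<Phi>"
  obtains K :: "nat \<Rightarrow> nat \<Rightarrow> nat \<Rightarrow> complex" and N where
    "\<And>X. X \<in> carrier_mat n n \<Longrightarrow> \<Phi> X = kraus_map n m {..<N} K X"
    "\<And>i j. i < n \<Longrightarrow> j < n \<Longrightarrow>
      (\<Sum>c<N. \<Sum>p<m. cnj (K c p i) * K c p j) = (if i = j then 1 else 0)"
proof -
  have lin: "linear_superop n m \<Phi>" and tp: "trace_preserving n \<Phi>"
    and cp: "positive_superop (n * n) (n * m) (ampliation n n m \<Phi>)"
    using ch by (auto simp: quantum_channel_def completely_positive_def)
  have car: "\<Phi> Y \<in> carrier_mat m m" if "Y \<in> carrier_mat n n" for Y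
    using lin that by (auto simp: linear_superop_def)
  \<comment> \<open>\<open>I\<close> encodes a pair of indices, so \<open>w\<close> is the sum of
    the vectors \<open>e\<^sub>i \<otimes> e\<^sub>i\<close>.\<close>
  define w where "w I = (if I div n = I mod n then 1 else 0 :: complex)" for I
  define \<Omega> where "\<Omega> = mat (n * n) (n * n) (\<lambda>(I, J). w I * w J)"
  have \<Omega>: "\<Omega> \<in> carrier_mat (n * n) (n * n)" by (simp add: \<Omega>_def)
  have "psd_mat (n * n) \<Omega>"
    unfolding psd_mat_quad_form[OF \<Omega>]
  proof
    fix f
    show "0 \<le> quad_form (n * n) (\<lambda>i j. \<Omega> $$ (i, j)) f"
      by (rule gram_psd[where S = "{()}" and y = "\<lambda>_. w"]) (auto simp: \<Omega>_def w_def)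
  qed
  then have psd: "psd_mat (n * m) (ampliation n n m \<Phi> \<Omega>)"
    using cp by (simp add: positive_superop_def)
  have "ampliation n n m \<Phi> \<Omega> \<in> carrier_mat (n * m) (n * m)" by (simp add: ampliation_def)
  then obtain v where v: "\<And>i j. i < n * m \<Longrightarrow> j < n * m \<Longrightarrow>
      ampliation n n m \<Phi> \<Omega> $$ (i, j) = (\<Sum>d<n * m. v d i * cnj (v d j))"
    using psd psd_factorization[of "n * m" "\<lambda>i j. ampliation n n m \<Phi> \<Omega> $$ (i, j)"]
    unfolding psd_mat_quad_form[OF \<open>ampliation n n m \<Phi> \<Omega> \<in> carrier_mat (n * m) (n * m)\<close>]
    by blast
  \<comment> \<open>Block \<open>i\<close> of the vector \<open>v c\<close> becomes column
    \<open>i\<close> of a Kraus operator.\<close>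
  define K where "K c p i = v c (i * m + p)" for c p i
  have unit: "\<Phi> (unit_mat n i j) $$ (p, q) = (\<Sum>c<n * m. K c p i * cnj (K c q j))"
    if "i < n" "j < n" "p < m" "q < m" for i j p q
  proof -
    \<comment> \<open>The blocks of \<Omega> are the matrix units, so the blocks of its ampliation
      are the values of \<Phi> on them.\<close>
    have "mat n n (\<lambda>(a, b). \<Omega> $$ (i * n + a, j * n + b)) = unit_mat n i j"
      using that by (intro eq_matI) (auto simp: \<Omega>_def w_def mult_add_bound)
    then have "\<Phi> (unit_mat n i j) $$ (p, q) = ampliation n n m \<Phi> \<Omega> $$ (i * m + p, j * m + q)"
      using that by (simp add: ampliation_def mult_add_bound)
    then show ?thesis using that by (simp add: v mult_add_bound K_def)
  qed
  show ?thesis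
  proof (rule that[of "n * m" K])
    fix X :: "complex mat" assume X: "X \<in> carrier_mat n n"
    show "\<Phi> X = kraus_map n m {..<n * m} K X"
    proof (rule eq_matI)
      fix p q assume "p < dim_row (kraus_map n m {..<n * m} K X)"
        "q < dim_col (kraus_map n m {..<n * m} K X)"
      then have pq: "p < m" "q < m" by (auto simp: kraus_map_def)
      have "\<Phi> X $$ (p, q) = (\<Sum>i<n. \<Sum>j<n. X $$ (i, j) * kraus_map n m {..<n * m} K (unit_mat n i j) $$ (p, q))"
        unfolding linear_superop_expand[OF lin X pq] using pq
        by (intro sum.cong refl) (simp add: unit kraus_map_unit)
      also have "\<dots> = kraus_map n m {..<n * m} K X $$ (p, q)"
        by (rule linear_superop_expand[OF kraus_map_linear X pq, symmetric])
      finally show "\<Phi> X $$ (p, q) = kraus_map n m {..<n * m} K X $$ (p, q)" .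
    qed (use car[OF X] in \<open>auto simp: kraus_map_def\<close>)
  next
    fix i j assume ij: "i < n" "j < n"
    have "(\<Sum>c<n * m. \<Sum>p<m. cnj (K c p i) * K c p j) = (\<Sum>p<m. \<Phi> (unit_mat n j i) $$ (p, p))"
      by (subst sum.swap) (simp add: unit ij mult.commute)
    also have "\<dots> = mat_trace (\<Phi> (unit_mat n j i))"
      using car[OF unit_mat_carrier, of j i] by (simp add: mat_trace_def)
    also have "\<dots> = mat_trace (unit_mat n j i)"
      using tp by (simp add: trace_preserving_def)
    also have "\<dots> = (\<Sum>p<n. if p = j then if i = j then 1 else 0 else 0)"
      unfolding mat_trace_def by (intro sum.cong) auto
    also have "\<dots> = (if i = j then 1 else 0)" using ij by simp
    finally show "(\<Sum>c<n * m. \<Sum>p<m. cnj (K c p i) * K c p j) = (if i = j then 1 else 0)" .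
  qed
qed

section \<open>Composition of channels\<close>

lemma ampliation_comp:
  assumes "linear_superop n m \<Phi>"
  shows "ampliation k n l (\<Psi> \<circ> \<Phi>) X = ampliation k m l \<Psi> (ampliation k n m \<Phi> X)"
proof (rule eq_matI)
  fix I J assume "I < dim_row (ampliation k m l \<Psi> (ampliation k n m \<Phi> X))"
    "J < dim_col (ampliation k m l \<Psi> (ampliation k n m \<Phi> X))"
  then have IJ: "I < k * l" "J < k * l" by (simp_all add: ampliation_def)
  note b = div_mod_bound[OF IJ(1)] div_mod_bound[OF IJ(2)]
  let ?B = "mat n n (\<lambda>(a, b). X $$ (I div l * n + a, J div l * n + b))"
  have "?B \<in> carrier_mat n n" by simp
  then have "\<Phi> ?B \<in> carrier_mat m m" using assms unfolding linear_superop_def by blast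
  then have "mat m m (\<lambda>(a, b). ampliation k n m \<Phi> X $$ (I div l * m + a, J div l * m + b)) = \<Phi> ?B"
    using b by (intro eq_matI) (auto simp: ampliation_def mult_add_bound)
  then show "ampliation k n l (\<Psi> \<circ> \<Phi>) X $$ (I, J) =
      ampliation k m l \<Psi> (ampliation k n m \<Phi> X) $$ (I, J)"
    using IJ by (simp add: ampliation_def[of k m l] ampliation_def[of k n l])
qed (simp_all add: ampliation_def)

lemma quantum_channel_comp:
  assumes "quantum_channel n m \<Phi>" "quantum_channel m k \<Psi>"
  shows "quantum_channel n k (\<Psi> \<circ> \<Phi>)"
proof -
  have lin: "linear_superop n m \<Phi>" using assms by (simp add: quantum_channel_def)
  have "trace_preserving n (\<Psi> \<circ> \<Phi>)"
    using assms by (auto simp: quantum_channel_def trace_preserving_def linear_superop_def)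
  moreover have "completely_positive n k (\<Psi> \<circ> \<Phi>)"
    using assms
    by (auto simp: quantum_channel_def completely_positive_def positive_superop_def
        ampliation_comp[OF lin])
  ultimately show ?thesis
    using assms linear_superop_comp by (auto simp: quantum_channel_def)
qed


section \<open>Block-diagonal algebras and the pinching\<close>

text \<open>The number of the block containing the coordinate \<open>i\<close>; coordinates out of
  range get \<open>length ds\<close>.\<close>

fun blk :: "nat list \<Rightarrow> nat \<Rightarrow> nat" where
  "blk [] i = 0"
| "blk (d # ds) i = (if i < d then 0 else Suc (blk ds (i - d)))"

lemma blk_less: "i < sum_list ds \<Longrightarrow> blk ds i < length ds"
  by (induction ds arbitrary: i) auto

text \<open>Makes membership a condition on entries, so that block decompositions no longer appear
  afterwards. The induction splits off the first block as a corner of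
  \<open>four_block_mat\<close>.\<close>

lemma block_diag_algebra_iff:
  "A \<in> block_diag_algebra ds \<longleftrightarrow> A \<in> carrier_mat (sum_list ds) (sum_list ds) \<and>
     (\<forall>i < sum_list ds. \<forall>j < sum_list ds. blk ds i \<noteq> blk ds j \<longrightarrow> A $$ (i, j) = 0)"
proof (induction ds arbitrary: A)
  case Nil
  then show ?case by (auto simp: block_diag_algebra_def)
next
  case (Cons d ds)
  let ?l = "sum_list ds"
  have Cons_iff: "A \<in> block_diag_algebra (d # ds) \<longleftrightarrow>
      (\<exists>B D. B \<in> carrier_mat d d \<and> D \<in> block_diag_algebra ds \<and>
        A = four_block_mat B (0\<^sub>m (dim_row B) (dim_col D)) (0\<^sub>m (dim_row D) (dim_col B)) D)"
  proof -
    have "A \<in> block_diag_algebra (d # ds) \<longleftrightarrow> (\<exists>B Bs. B \<in> carrier_mat d d \<and>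
        list_all2 (\<lambda>d B. B \<in> carrier_mat d d) ds Bs \<and> A = diag_block_mat (B # Bs))"
      unfolding block_diag_algebra_def mem_Collect_eq list_all2_Cons1 by blast
    also have "\<dots> \<longleftrightarrow> (\<exists>B D. B \<in> carrier_mat d d \<and> D \<in> block_diag_algebra ds \<and>
        A = four_block_mat B (0\<^sub>m (dim_row B) (dim_col D)) (0\<^sub>m (dim_row D) (dim_col B)) D)"
      unfolding block_diag_algebra_def diag_block_mat.simps Let_def by blast
    finally show ?thesis .
  qed
  show ?case
  proof
    assume "A \<in> block_diag_algebra (d # ds)"
    then obtain B D where B: "B \<in> carrier_mat d d" and D: "D \<in> block_diag_algebra ds"
      and A: "A = four_block_mat B (0\<^sub>m (dim_row B) (dim_col D)) (0\<^sub>m (dim_row D) (dim_col B)) D"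
      unfolding Cons_iff by blast
    note D' = D[unfolded Cons.IH]
    then show "A \<in> carrier_mat (sum_list (d # ds)) (sum_list (d # ds)) \<and>
      (\<forall>i < sum_list (d # ds). \<forall>j < sum_list (d # ds).
        blk (d # ds) i \<noteq> blk (d # ds) j \<longrightarrow> A $$ (i, j) = 0)"
      using B unfolding A by auto
  next
    assume A: "A \<in> carrier_mat (sum_list (d # ds)) (sum_list (d # ds)) \<and>
      (\<forall>i < sum_list (d # ds). \<forall>j < sum_list (d # ds).
        blk (d # ds) i \<noteq> blk (d # ds) j \<longrightarrow> A $$ (i, j) = 0)"
    define B where "B = mat d d (\<lambda>(i, j). A $$ (i, j))"
    define D where "D = mat ?l ?l (\<lambda>(i, j). A $$ (i + d, j + d))"
    have "D \<in> block_diag_algebra ds"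
      unfolding Cons.IH using A by (auto simp: D_def)
    moreover have "A = four_block_mat B (0\<^sub>m (dim_row B) (dim_col D)) (0\<^sub>m (dim_row D) (dim_col B)) D"
      using A by (intro eq_matI) (auto simp: B_def D_def)
    moreover have "B \<in> carrier_mat d d" by (simp add: B_def)
    ultimately show "A \<in> block_diag_algebra (d # ds)"
      unfolding Cons_iff by blast
  qed
qed

lemma block_diag_algebra_carrier:
  "A \<in> block_diag_algebra ds \<Longrightarrow> A \<in> carrier_mat (sum_list ds) (sum_list ds)"
  by (simp add: block_diag_algebra_iff)

lemma block_diag_algebra_off_diag:
  "A \<in> block_diag_algebra ds \<Longrightarrow> i < sum_list ds \<Longrightarrow> j < sum_list ds \<Longrightarrow>
     blk ds i \<noteq> blk ds j \<Longrightarrow> A $$ (i, j) = 0"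
  by (simp add: block_diag_algebra_iff)

lemma one_in_block_diag_algebra: "1\<^sub>m (sum_list ds) \<in> block_diag_algebra ds"
  by (auto simp: block_diag_algebra_iff)

lemma unit_in_block_diag_algebra:
  "blk ds i = blk ds j \<Longrightarrow> unit_mat (sum_list ds) i j \<in> block_diag_algebra ds"
  by (auto simp: block_diag_algebra_iff)

lemma star_subalgebra_block_diag:
  assumes "0 < sum_list ds"
  shows "star_subalgebra (sum_list ds) (block_diag_algebra ds)"
proof -
  let ?l = "sum_list ds"
  have "1\<^sub>m ?l $$ (0, 0) \<noteq> (0\<^sub>m ?l ?l :: complex mat) $$ (0, 0)" using assms by simp
  then have "block_diag_algebra ds \<noteq> {0\<^sub>m ?l ?l}"
    using one_in_block_diag_algebra[of ds] by auto
  moreover have "X * Y \<in> block_diag_algebra ds"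
    if X: "X \<in> block_diag_algebra ds" and Y: "Y \<in> block_diag_algebra ds" for X Y
  proof -
    note c = block_diag_algebra_carrier[OF X] block_diag_algebra_carrier[OF Y]
    have "(X * Y) $$ (i, j) = 0" if "i < ?l" "j < ?l" "blk ds i \<noteq> blk ds j" for i j
      unfolding mat_mult_entry[OF c that(1,2)]
    proof (intro sum.neutral ballI)
      fix k assume "k \<in> {..<?l}"
      then show "X $$ (i, k) * Y $$ (k, j) = 0"
        using block_diag_algebra_off_diag[OF X, of i k] block_diag_algebra_off_diag[OF Y, of k j] that
        by fastforce
    qed
    then show ?thesis unfolding block_diag_algebra_iff using c by simp
  qed
  ultimately show ?thesis
    unfolding star_subalgebra_def by (auto simp: block_diag_algebra_iff)
qed

text \<open>Stated for a predicate rather than one block number, since the induction on the list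
  shifts block numbers by \<open>Suc\<close>.\<close>

lemma diag_block_mat_indicator:
  "diag_block_mat (map (\<lambda>i. if P i then 1\<^sub>m (ds ! i) else 0\<^sub>m (ds ! i) (ds ! i)) [0..<length ds]) =
     mat (sum_list ds) (sum_list ds) (\<lambda>(i, j). if i = j \<and> P (blk ds i) then 1 else 0 :: complex)"
proof (induction ds arbitrary: P)
  case Nil
  then show ?case by (intro eq_matI) auto
next
  case (Cons d ds)
  have eq: "map (\<lambda>i. if P i then 1\<^sub>m ((d # ds) ! i) else 0\<^sub>m ((d # ds) ! i) ((d # ds) ! i))
      [0..<length (d # ds)] =
    (if P 0 then 1\<^sub>m d else 0\<^sub>m d d) #
      map (\<lambda>i. if P (Suc i) then 1\<^sub>m (ds ! i) else 0\<^sub>m (ds ! i) (ds ! i)) [0..<length ds]"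
    by (simp add: upt_conv_Cons map_Suc_upt[symmetric] del: upt_Suc)
  then show ?case
    unfolding eq diag_block_mat.simps Let_def Cons.IH[of "\<lambda>i. P (Suc i)"]
    by (intro eq_matI) auto
qed

section \<open>The pinching in coordinates\<close>

lemma block_proj_eq:
  "block_proj ds k = mat (sum_list ds) (sum_list ds) (\<lambda>(i, j). if i = j \<and> blk ds i = k then 1 else 0)"
  unfolding block_proj_def by (rule diag_block_mat_indicator)

lemma foldr_add_mat:
  assumes "\<And>k. k \<in> set ks \<Longrightarrow> g k \<in> carrier_mat n n"
  shows "foldr (+) (map g ks) (0\<^sub>m n n) =
    mat n n (\<lambda>(i, j). \<Sum>k\<leftarrow>ks. g k $$ (i, j) :: complex)"
  using assms
proof (induction ks)
  case Nil
  show ?case by (intro eq_matI) auto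
next
  case (Cons k ks)
  then have "g k \<in> carrier_mat n n" by simp
  then show ?case using Cons by (simp, intro eq_matI) auto
qed

text \<open>Conjugation by the \<open>k\<close>-th projection keeps the entries with both indices in
  block \<open>k\<close>, and each row index lies in exactly one block.\<close>

lemma pinching_eq:
  assumes X: "X \<in> carrier_mat (sum_list ds) (sum_list ds)"
  shows "pinching ds X = mat (sum_list ds) (sum_list ds)
    (\<lambda>(i, j). if blk ds i = blk ds j then X $$ (i, j) else 0)"
proof -
  let ?l = "sum_list ds"
  have P: "block_proj ds k \<in> carrier_mat ?l ?l" for k by (simp add: block_proj_eq)
  have entry: "(block_proj ds k * X * block_proj ds k) $$ (i, j) =
      (if blk ds i = k then if blk ds j = k then X $$ (i, j) else 0 else 0)"
    if "i < ?l" "j < ?l" for i j k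
  proof -
    have "(block_proj ds k * X * block_proj ds k) $$ (i, j) =
      (\<Sum>a<?l. \<Sum>b<?l. if b = j then if a = i then
        if blk ds i = k then if blk ds j = k then X $$ (i, j) else 0 else 0 else 0 else 0)"
      unfolding mat_mult3_entry[OF P X P that]
      using that by (intro sum.cong refl) (auto simp: block_proj_eq)
    then show ?thesis using that by simp
  qed
  have "pinching ds X = mat ?l ?l (\<lambda>(i, j).
      \<Sum>k\<leftarrow>[0..<length ds]. (block_proj ds k * X * block_proj ds k) $$ (i, j))"
    unfolding pinching_def by (intro foldr_add_mat mult_carrier_mat[OF mult_carrier_mat[OF P X] P])
  also have "\<dots> = mat ?l ?l (\<lambda>(i, j). if blk ds i = blk ds j then X $$ (i, j) else 0)"
    (is "mat ?l ?l ?f = mat ?l ?l ?g")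
  proof (rule eq_matI)
    fix i j assume "i < dim_row (mat ?l ?l ?g)" "j < dim_col (mat ?l ?l ?g)"
    then have ij: "i < ?l" "j < ?l" by simp_all
    have "mat ?l ?l ?f $$ (i, j) = (\<Sum>k<length ds.
        if k = blk ds i then if blk ds j = blk ds i then X $$ (i, j) else 0 else 0)"
      using ij
      by (auto simp: entry interv_sum_list_conv_sum_set_nat lessThan_atLeast0
          simp del: index_mult_mat(1) intro!: sum.cong)
    then show "mat ?l ?l ?f $$ (i, j) = mat ?l ?l ?g $$ (i, j)"
      using ij blk_less[of i ds] by auto
  qed simp_all
  finally show ?thesis .
qed

lemma pinching_entry:
  assumes "X \<in> carrier_mat (sum_list ds) (sum_list ds)" "i < sum_list ds" "j < sum_list ds"
  shows "pinching ds X $$ (i, j) = (if blk ds i = blk ds j then X $$ (i, j) else 0)"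
  using assms by (simp add: pinching_eq)

lemma pinching_carrier [simp]:
  "X \<in> carrier_mat (sum_list ds) (sum_list ds) \<Longrightarrow>
    pinching ds X \<in> carrier_mat (sum_list ds) (sum_list ds)"
  by (simp add: pinching_eq)

text \<open>The form of the pinching at \<open>f\<close> is the sum over \<open>k\<close> of the
  form of \<open>X\<close> at \<open>g k\<close>, the restriction of \<open>f\<close> to block
  \<open>k\<close>.\<close>

lemma pinching_positive:
  assumes "psd_mat (sum_list ds) X"
  shows "psd_mat (sum_list ds) (pinching ds X)"
proof -
  let ?l = "sum_list ds"
  have X: "X \<in> carrier_mat ?l ?l" using assms by (simp add: psd_mat_def)
  have "0 \<le> quad_form ?l (\<lambda>i j. pinching ds X $$ (i, j)) f" for f
  proof -
    define g where "g k i = (if k = blk ds i then f i else 0)" for k i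
    have "quad_form ?l (\<lambda>i j. pinching ds X $$ (i, j)) f =
        (\<Sum>i<?l. \<Sum>j<?l. \<Sum>k<length ds. cnj (g k i) * X $$ (i, j) * g k j)"
      unfolding quad_form_def
    proof (intro sum.cong refl)
      fix i j assume ij: "i \<in> {..<?l}" "j \<in> {..<?l}"
      have "(\<Sum>k<length ds. cnj (g k i) * X $$ (i, j) * g k j) = (\<Sum>k<length ds.
          if k = blk ds i then cnj (f i) * pinching ds X $$ (i, j) * f j else 0)"
        using ij by (intro sum.cong refl) (auto simp: g_def pinching_entry[OF X])
      then show "cnj (f i) * pinching ds X $$ (i, j) * f j =
          (\<Sum>k<length ds. cnj (g k i) * X $$ (i, j) * g k j)"
        using ij blk_less[of i ds] by simp
    qed
    also have "\<dots> = (\<Sum>i<?l. \<Sum>k<length ds. \<Sum>j<?l. cnj (g k i) * X $$ (i, j) * g k j)"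
      by (intro sum.cong refl sum.swap)
    also have "\<dots> = (\<Sum>k<length ds. quad_form ?l (\<lambda>i j. X $$ (i, j)) (g k))"
      unfolding quad_form_def by (rule sum.swap)
    also have "0 \<le> \<dots>"
      using assms by (intro sum_nonneg) (simp add: psd_mat_quad_form[OF X])
    finally show ?thesis .
  qed
  then show ?thesis by (simp add: psd_mat_quad_form[OF pinching_carrier[OF X]])
qed

text \<open>\<open>X\<close> and \<open>Y\<close> preserve blocks, so a nonzero term has
  \<open>a\<close> in the block of \<open>i\<close> and \<open>b\<close> in the block of
  \<open>j\<close>. Hence it makes no difference whether the pinching tests (\<open>i\<close>,
  \<open>j\<close>) or (\<open>a\<close>, \<open>b\<close>).\<close>

lemma pinching_bimodule:
  assumes X: "X \<in> block_diag_algebra ds" and Y: "Y \<in> block_diag_algebra ds"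
    and Z: "Z \<in> carrier_mat (sum_list ds) (sum_list ds)"
  shows "pinching ds (X * Z * Y) = X * pinching ds Z * Y"
proof -
  let ?l = "sum_list ds"
  note c = block_diag_algebra_carrier[OF X] block_diag_algebra_carrier[OF Y]
  have XZY: "X * Z * Y \<in> carrier_mat ?l ?l" using c Z by simp
  have "pinching ds (X * Z * Y) $$ (i, j) = (X * pinching ds Z * Y) $$ (i, j)"
    if ij: "i < ?l" "j < ?l" for i j
    unfolding pinching_entry[OF XZY ij] mat_mult3_entry[OF c(1) Z c(2) ij]
      mat_mult3_entry[OF c(1) pinching_carrier[OF Z] c(2) ij]
  proof (cases "blk ds i = blk ds j")
    case True
    have "X $$ (i, a) * Z $$ (a, b) * Y $$ (b, j) = X $$ (i, a) * pinching ds Z $$ (a, b) * Y $$ (b, j)"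
      if "a < ?l" "b < ?l" for a b
      using block_diag_algebra_off_diag[OF X ij(1) that(1)]
        block_diag_algebra_off_diag[OF Y that(2) ij(2)] True
      by (cases "X $$ (i, a) = 0 \<or> Y $$ (b, j) = 0") (auto simp: pinching_entry[OF Z that], metis)
    then show "(if blk ds i = blk ds j
        then \<Sum>a<?l. \<Sum>b<?l. X $$ (i, a) * Z $$ (a, b) * Y $$ (b, j) else 0) =
      (\<Sum>a<?l. \<Sum>b<?l. X $$ (i, a) * pinching ds Z $$ (a, b) * Y $$ (b, j))"
      unfolding if_P[OF True] by (intro sum.cong refl) simp
  next
    case False
    have "X $$ (i, a) * pinching ds Z $$ (a, b) * Y $$ (b, j) = 0" if "a < ?l" "b < ?l" for a b
      using block_diag_algebra_off_diag[OF X ij(1) that(1)]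
        block_diag_algebra_off_diag[OF Y that(2) ij(2)] False
      by (cases "X $$ (i, a) = 0 \<or> Y $$ (b, j) = 0") (auto simp: pinching_entry[OF Z that], metis)
    then show "(if blk ds i = blk ds j
        then \<Sum>a<?l. \<Sum>b<?l. X $$ (i, a) * Z $$ (a, b) * Y $$ (b, j) else 0) =
      (\<Sum>a<?l. \<Sum>b<?l. X $$ (i, a) * pinching ds Z $$ (a, b) * Y $$ (b, j))"
      unfolding if_not_P[OF False] by (intro sum.neutral ballI sym[where t = 0]) simp
  qed
  then show ?thesis
    using carrier_matD[OF pinching_carrier[OF XZY]] c by (intro eq_matI) auto
qed

text \<open>Trace preservation and the bimodule property determine \<open>F X\<close> against the matrix units of the
  algebra: \<open>Tr (u (F X)) = Tr (F (u X)) = Tr (u X)\<close>.\<close>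

lemma trace_preserving_conditional_expectation_iff:
  "conditional_expectation (sum_list ds) (block_diag_algebra ds) F \<and>
      trace_preserving (sum_list ds) F \<longleftrightarrow>
    (\<forall>X \<in> carrier_mat (sum_list ds) (sum_list ds). F X = pinching ds X)"
    (is "?CE \<longleftrightarrow> ?P")
proof
  let ?l = "sum_list ds"
  assume CE: ?CE
  show ?P
  proof
    fix X :: "complex mat" assume X: "X \<in> carrier_mat ?l ?l"
    have FA: "F X \<in> block_diag_algebra ds" using CE X by (auto simp: conditional_expectation_def)
    note FX = block_diag_algebra_carrier[OF FA]
    show "F X = pinching ds X"
    proof (rule eq_matI)
      fix i j assume "i < dim_row (pinching ds X)" "j < dim_col (pinching ds X)"
      then have ij: "i < ?l" "j < ?l" using X by (auto simp: pinching_eq)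
      show "F X $$ (i, j) = pinching ds X $$ (i, j)"
      proof (cases "blk ds i = blk ds j")
        case True
        let ?u = "unit_mat ?l j i"
        have u: "?u \<in> block_diag_algebra ds" using True by (intro unit_in_block_diag_algebra) simp
        have uX: "?u * X \<in> carrier_mat ?l ?l" by (rule mult_carrier_mat[OF unit_mat_carrier X])
        \<comment> \<open>The bimodule property is two-sided, so the identity is inserted on the
          right.\<close>
        have "F (?u * X * 1\<^sub>m ?l) = ?u * F X * 1\<^sub>m ?l"
          using CE u X one_in_block_diag_algebra[of ds] unfolding conditional_expectation_def by blast
        moreover have "?u * F X \<in> carrier_mat ?l ?l" by (rule mult_carrier_mat[OF unit_mat_carrier FX])
        ultimately have "F (?u * X) = ?u * F X"
          unfolding right_mult_one_mat[OF uX] by (simp only: right_mult_one_mat)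
        then have "F X $$ (i, j) = mat_trace (F (?u * X))"
          using mat_trace_unit[OF FX ij] by simp
        also have "\<dots> = mat_trace (?u * X)" using CE uX by (auto simp: trace_preserving_def)
        also have "\<dots> = X $$ (i, j)" by (rule mat_trace_unit[OF X ij])
        finally show ?thesis using True by (simp add: pinching_entry[OF X ij])
      qed (simp add: pinching_entry[OF X ij] block_diag_algebra_off_diag[OF FA ij])
    qed (use FX X in \<open>auto simp: pinching_eq\<close>)
  qed
next
  let ?l = "sum_list ds"
  assume P: ?P
  have lin: "linear_superop ?l ?l F"
    using P unfolding linear_superop_def by (auto simp: pinching_eq intro!: eq_matI)
  have in_A: "pinching ds X \<in> block_diag_algebra ds" if "X \<in> carrier_mat ?l ?l" for X
    unfolding block_diag_algebra_iff using that by (auto simp: pinching_entry)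
  have fixed: "pinching ds X = X" if X: "X \<in> block_diag_algebra ds" for X
    using block_diag_algebra_carrier[OF X] block_diag_algebra_off_diag[OF X]
    by (intro eq_matI) (auto simp: pinching_eq)
  have pos: "positive_superop ?l ?l F"
    unfolding positive_superop_def using P pinching_positive by (auto simp: psd_mat_def)
  have bim: "F (X * Z * Y) = X * F Z * Y" if "X \<in> block_diag_algebra ds" "Y \<in> block_diag_algebra ds"
    "Z \<in> carrier_mat ?l ?l" for X Y Z
  proof -
    have "X * Z * Y \<in> carrier_mat ?l ?l"
      using that block_diag_algebra_carrier[OF that(1)] block_diag_algebra_carrier[OF that(2)] by simp
    then show ?thesis using P that(3) pinching_bimodule[OF that] by simp
  qed
  have "trace_preserving ?l F"
    using P by (auto simp: trace_preserving_def mat_trace_def pinching_eq)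
  then show ?CE
    unfolding conditional_expectation_def
    using lin pos in_A fixed bim P block_diag_algebra_carrier by auto
qed


section \<open>From a transmitted algebra to channels\<close>

text \<open>A representative index for each block, used to make one choice per block.\<close>

definition blk_start :: "nat list \<Rightarrow> nat \<Rightarrow> nat" where
  "blk_start ds i = (LEAST j. blk ds j = blk ds i)"

lemma blk_blk_start [simp]: "blk ds (blk_start ds i) = blk ds i"
  unfolding blk_start_def by (rule LeastI) simp

lemma blk_start_less: "i < l \<Longrightarrow> blk_start ds i < l"
  unfolding blk_start_def by (rule le_less_trans[OF Least_le]) simp_all

lemma blk_start_cong: "blk ds i = blk ds j \<Longrightarrow> blk_start ds i = blk_start ds j"
  by (simp add: blk_start_def)

text \<open>A single Kraus operator satisfies the trace condition exactly when it is an
  isometry.\<close>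

lemma isometry_channel:
  assumes W: "W \<in> carrier_mat m n" and iso: "mat_adjoint W * W = 1\<^sub>m n"
  obtains E where "quantum_channel n m E"
    "\<And>X. X \<in> carrier_mat n n \<Longrightarrow> E X = W * X * mat_adjoint W"
proof
  show "quantum_channel n m (kraus_map n m {()} (\<lambda>_ p i. W $$ (p, i)))"
  proof (rule kraus_map_channel)
    fix i j assume ij: "i < n" "j < n"
    have "(mat_adjoint W * W) $$ (i, j) = (\<Sum>p<m. cnj (W $$ (p, i)) * W $$ (p, j))"
      using W ij by (auto simp: mat_mult_entry[OF mat_adjoint_carrier[OF W] W]
          simp del: index_mult_mat(1) intro!: sum.cong)
    then show "(\<Sum>c\<in>{()}. \<Sum>p<m. cnj (W $$ (p, i)) * W $$ (p, j)) = (if i = j then 1 else 0)"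
      using ij by (simp add: iso)
  qed
  fix X :: "complex mat" assume X: "X \<in> carrier_mat n n"
  show "kraus_map n m {()} (\<lambda>_ p i. W $$ (p, i)) X = W * X * mat_adjoint W"
    using W by (intro eq_matI)
      (auto simp: kraus_map_def mat_mult_adjoint_entry[OF W X] simp del: index_mult_mat(1))
qed

text \<open>For a projection, a diagonal entry is the squared norm of its column. A nonzero column
  therefore yields, after normalisation, a unit vector in the range.\<close>

lemma projection_diag_pos:
  assumes Q: "Q \<in> carrier_mat n n" and herm: "mat_adjoint Q = Q" and idem: "Q * Q = Q"
    and nz: "Q \<noteq> 0\<^sub>m n n"
  shows "\<exists>c<n. \<exists>t > 0. Q $$ (c, c) = complex_of_real t"
proof -
  obtain p c where pc: "p < n" "c < n" "Q $$ (p, c) \<noteq> 0"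
    using nz Q by (metis carrier_matD eq_matI index_zero_mat)
  let ?t = "\<Sum>k<n. (cmod (Q $$ (k, c)))\<^sup>2"
  have "Q $$ (c, c) = (mat_adjoint Q * Q) $$ (c, c)" by (simp add: herm idem)
  also have "\<dots> = (\<Sum>k<n. cnj (Q $$ (k, c)) * Q $$ (k, c))"
    using Q pc by (auto simp: mat_mult_entry[OF mat_adjoint_carrier[OF Q] Q]
        simp del: index_mult_mat(1) intro!: sum.cong)
  also have "\<dots> = complex_of_real ?t"
    by (simp add: complex_norm_square mult.commute del: of_real_power)
  finally have "Q $$ (c, c) = complex_of_real ?t" .
  moreover have "0 < ?t" using pc by (intro sum_pos2[of _ p]) auto
  ultimately show ?thesis using pc(2) by blast
qed

lemma transmittable_imp_channels:
  assumes \<Phi>: "quantum_channel n m \<Phi>"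
    and trans: "transmittable (sum_list ds) (block_diag_algebra ds) n m \<Phi>"
  shows "\<exists>\<E> \<D>. quantum_channel (sum_list ds) n \<E> \<and> quantum_channel m (sum_list ds) \<D> \<and>
    (\<forall>X \<in> carrier_mat (sum_list ds) (sum_list ds). (\<D> \<circ> \<Phi> \<circ> \<E>) X = pinching ds X)"
proof -
  let ?l = "sum_list ds" and ?A = "block_diag_algebra ds"
  let ?e = "unit_mat (sum_list ds)" and ?s = "blk_start ds"
  from trans obtain \<pi> where sub: "star_subalgebra ?l ?A"
    and hom: "star_hom_on n ?A \<pi>" and inj: "inj_on \<pi> ?A" and "correctable n m \<Phi> (\<pi> ` ?A)"
    unfolding transmittable_def by blast
  then obtain P r V D where unit: "is_unit_of (\<pi> ` ?A) P"
    and V_incl: "is_range_inclusion n P r V" and D: "quantum_channel m r D"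
    and corr': "\<forall>X \<in> (\<lambda>B. mat_adjoint V * B * V) ` \<pi> ` ?A.
      superop_adjoint r r (D \<circ> restrict_superop V \<Phi>) X = X"
    unfolding correctable_def by blast
  have corr: "superop_adjoint r r (D \<circ> restrict_superop V \<Phi>)
      (mat_adjoint V * \<pi> a * V) = mat_adjoint V * \<pi> a * V" if "a \<in> ?A" for a
    by (rule bspec[OF corr' imageI[OF imageI[OF that]]])
  have V: "V \<in> carrier_mat n r" and VV: "mat_adjoint V * V = 1\<^sub>m r" and VP: "V * mat_adjoint V = P"
    using V_incl by (auto simp: is_range_inclusion_def)
  have car: "\<pi> a \<in> carrier_mat n n" if "a \<in> ?A" for a using hom that by (simp add: star_hom_on_def)
  have \<pi>_mult: "\<pi> (a * b) = \<pi> a * \<pi> b" if "a \<in> ?A" "b \<in> ?A" for a b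
    using hom that by (simp add: star_hom_on_def)
  have \<pi>_smult: "\<pi> (c \<cdot>\<^sub>m a) = c \<cdot>\<^sub>m \<pi> a" if "a \<in> ?A" for c a
    using hom that by (simp add: star_hom_on_def)
  have \<pi>_adj: "\<pi> (mat_adjoint a) = mat_adjoint (\<pi> a)" if "a \<in> ?A" for a
    using hom that by (simp add: star_hom_on_def)
  have eA: "?e i j \<in> ?A" if "blk ds i = blk ds j" for i j
    by (rule unit_in_block_diag_algebra[OF that])
  have A0: "0\<^sub>m ?l ?l \<in> ?A" using sub by (simp add: star_subalgebra_def)
  have A_mult: "a * b \<in> ?A" if "a \<in> ?A" "b \<in> ?A" for a b
    using sub that by (simp add: star_subalgebra_def)
  have A1: "1\<^sub>m ?l \<in> ?A" by (rule one_in_block_diag_algebra)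
  have Ac: "a \<in> carrier_mat ?l ?l" if "a \<in> ?A" for a by (rule block_diag_algebra_carrier[OF that])
  have zero_smult: "0 \<cdot>\<^sub>m M = 0\<^sub>m k k" if "M \<in> carrier_mat k k" for M :: "complex mat" and k
    using that by (intro eq_matI) auto
  have \<pi>0: "\<pi> (0\<^sub>m ?l ?l) = 0\<^sub>m n n"
    using \<pi>_smult[OF A0, of 0] unfolding zero_smult[OF car[OF A0]] zero_smult[OF zero_carrier_mat] .
  \<comment> \<open>Both \<open>P\<close> and the image of the identity are units of the image of
    \<pi>.\<close>
  have P: "P = \<pi> (1\<^sub>m ?l)"
  proof -
    obtain x where x: "x \<in> ?A" "P = \<pi> x" using unit by (auto simp: is_unit_of_def)
    have "P * \<pi> (1\<^sub>m ?l) = P" using \<pi>_mult[OF x(1) A1] Ac[OF x(1)] x(2) by simp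
    moreover have "P * \<pi> (1\<^sub>m ?l) = \<pi> (1\<^sub>m ?l)" using unit A1 by (auto simp: is_unit_of_def)
    ultimately show ?thesis by simp
  qed
  have P_left: "P * \<pi> a = \<pi> a" and P_right: "\<pi> a * P = \<pi> a" if "a \<in> ?A" for a
    using unit that by (auto simp: is_unit_of_def)

  \<comment> \<open>The image of a diagonal matrix unit is a projection, nonzero because \<pi> is
    injective.\<close>
  have "\<exists>c t. c < n \<and> 0 < t \<and> \<pi> (?e i i) $$ (c, c) = complex_of_real t" if i: "i < ?l" for i
  proof -
    have e: "?e i i \<in> ?A" by (rule eA) simp
    have "?e i i \<noteq> 0\<^sub>m ?l ?l"
    proof
      assume "?e i i = 0\<^sub>m ?l ?l"
      then have "?e i i $$ (i, i) = 0" using i by simp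
      then show False using i by simp
    qed
    then have "\<pi> (?e i i) \<noteq> 0\<^sub>m n n" using inj_onD[OF inj _ e A0] \<pi>0 by auto
    moreover have "\<pi> (?e i i) * \<pi> (?e i i) = \<pi> (?e i i)"
      using \<pi>_mult[OF e e] i by (simp add: unit_mat_mult_unit_mat)
    moreover have "mat_adjoint (\<pi> (?e i i)) = \<pi> (?e i i)"
      using \<pi>_adj[OF e] by simp
    ultimately show ?thesis using projection_diag_pos[OF car[OF e]] by blast
  qed
  then obtain c t where c: "\<And>i. i < ?l \<Longrightarrow> c i < n" and t: "\<And>i. i < ?l \<Longrightarrow> 0 < t i"
    and ct: "\<And>i. i < ?l \<Longrightarrow> \<pi> (?e i i) $$ (c i, c i) = complex_of_real (t i)"
    by metis
  \<comment> \<open>The norm of column \<open>c i\<close> of the projection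
    \<open>\<pi> (?e i i)\<close>.\<close>
  define \<rho> where "\<rho> i = complex_of_real (sqrt (t i))" for i
  have \<rho>: "\<rho> i * \<rho> i = complex_of_real (t i)" "\<rho> i \<noteq> 0" if "i < ?l" for i
    using t[OF that] by (auto simp: \<rho>_def simp flip: of_real_mult)
  have cnj_\<rho>: "cnj (\<rho> i) = \<rho> i" for i by (simp add: \<rho>_def)

  text \<open>The columns of \<open>W\<close> in a block are the images of one unit vector in the range of the
    minimal projection \<open>\<pi> (e s s)\<close> under the matrix units \<open>\<pi> (e j s)\<close>, so that \<open>\<pi>\<close> acts on the
    range of \<open>W\<close> as the identity representation.\<close>
  define W where "W = mat n ?l (\<lambda>(h, j). \<pi> (?e j (?s j)) $$ (h, c (?s j)) / \<rho> (?s j))"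
  have W: "W \<in> carrier_mat n ?l" by (simp add: W_def)
  have W\<pi>W: "mat_adjoint W * \<pi> a * W = a" if a: "a \<in> ?A" for a
  proof (rule eq_matI)
    fix i j assume "i < dim_row a" "j < dim_col a"
    then have ij: "i < ?l" "j < ?l" using Ac[OF a] by auto
    note s = blk_start_less[OF ij(1), of ds] blk_start_less[OF ij(2), of ds]
    have e: "?e (?s i) i \<in> ?A" "?e j (?s j) \<in> ?A" "?e i (?s i) \<in> ?A" by (auto intro: eA)
    have Gi: "\<pi> (?e (?s i) i) $$ (x, h) = cnj (\<pi> (?e i (?s i)) $$ (h, x))"
      if "x < n" "h < n" for x h
      using \<pi>_adj[OF e(3)] car[OF e(3)] that by simp
    have "(mat_adjoint W * \<pi> a * W) $$ (i, j) =
        (\<Sum>h<n. \<Sum>h'<n. cnj (W $$ (h, i)) * \<pi> a $$ (h, h') * W $$ (h', j))"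
      unfolding mat_mult3_entry[OF mat_adjoint_carrier[OF W] car[OF a] W ij]
      using W ij by (intro sum.cong refl) auto
    also have "\<dots> = (\<Sum>h<n. \<Sum>h'<n. \<pi> (?e (?s i) i) $$ (c (?s i), h) * \<pi> a $$ (h, h') *
        \<pi> (?e j (?s j)) $$ (h', c (?s j))) / (\<rho> (?s i) * \<rho> (?s j))"
      unfolding sum_divide_distrib
      using ij c[OF s(1)] by (intro sum.cong refl) (simp add: W_def Gi cnj_\<rho>)
    also have "\<dots> = (\<pi> (?e (?s i) i) * \<pi> a * \<pi> (?e j (?s j))) $$ (c (?s i), c (?s j)) /
        (\<rho> (?s i) * \<rho> (?s j))"
      unfolding mat_mult3_entry[OF car[OF e(1)] car[OF a] car[OF e(2)] c[OF s(1)] c[OF s(2)]] ..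
    also have "\<pi> (?e (?s i) i) * \<pi> a * \<pi> (?e j (?s j)) = \<pi> (a $$ (i, j) \<cdot>\<^sub>m ?e (?s i) (?s j))"
      using \<pi>_mult[OF e(1) a] \<pi>_mult[OF A_mult[OF e(1) a] e(2)]
        unit_mat_sandwich[OF Ac[OF a] ij, of "?s i" "?s j"] by simp
    also have "\<pi> (a $$ (i, j) \<cdot>\<^sub>m ?e (?s i) (?s j)) $$ (c (?s i), c (?s j)) /
        (\<rho> (?s i) * \<rho> (?s j)) = a $$ (i, j)"
    proof (cases "blk ds i = blk ds j")
      case True
      then have sij: "?s i = ?s j" by (rule blk_start_cong)
      have e': "?e (?s j) (?s j) \<in> ?A" by (rule eA) simp
      show ?thesis
        unfolding sij \<pi>_smult[OF e'] using car[OF e'] c[OF s(2)] ct[OF s(2)] \<rho>[OF s(2)] t[OF s(2)]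
        by simp
    next
      case False
      then show ?thesis
        using block_diag_algebra_off_diag[OF a ij] zero_smult[OF unit_mat_carrier] \<pi>0
          c[OF s(1)] c[OF s(2)] by simp
    qed
    finally show "(mat_adjoint W * \<pi> a * W) $$ (i, j) = a $$ (i, j)" .
  qed (use Ac[OF a] W in auto)
  \<comment> \<open>The range of \<open>W\<close> lies in that of \<open>P\<close>. This turns
    \<open>W\<^sup>* P W = 1\<close> into the isometry property, and later lets \<open>W\<close>
    factor through \<open>V\<close>.\<close>
  have PW: "P * W = W"
  proof (rule eq_matI)
    fix h j assume "h < dim_row W" "j < dim_col W"
    then have hj: "h < n" "j < ?l" using W by auto
    have e: "?e j (?s j) \<in> ?A" by (rule eA) simp
    have Pc: "P \<in> carrier_mat n n" using car[OF A1] by (simp add: P)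
    note cj = c[OF blk_start_less[OF hj(2), of ds]]
    have "(P * W) $$ (h, j) = (P * \<pi> (?e j (?s j))) $$ (h, c (?s j)) / \<rho> (?s j)"
      unfolding mat_mult_entry[OF Pc W hj] mat_mult_entry[OF Pc car[OF e] hj(1) cj]
        sum_divide_distrib
      using hj by (intro sum.cong refl) (simp add: W_def)
    then show "(P * W) $$ (h, j) = W $$ (h, j)" using hj by (simp add: P_left[OF e] W_def)
  qed (use car[OF A1] W P in auto)
  have WW: "mat_adjoint W * W = 1\<^sub>m ?l"
    using W\<pi>W[OF A1] PW W car[OF A1] by (simp add: P[symmetric] mat_mult_assoc)
  obtain E where E: "quantum_channel ?l n E"
    and EX: "\<And>X. X \<in> carrier_mat ?l ?l \<Longrightarrow> E X = W * X * mat_adjoint W"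
    using isometry_channel[OF W WW] by blast

  \<comment> \<open>For \<open>i\<close> and \<open>j\<close> in one block,
    \<open>G\<^sub>i\<^sup>* G\<^sub>j\<close> is the compression of \<open>\<pi> (?e i j)\<close>
    by \<open>V\<close>. This Gram form supplies Kraus operators for the last stage of the
    decoder.\<close>
  define G where "G i = \<pi> (?e (?s i) i) * V" for i
  have G: "G i \<in> carrier_mat n r" for i
    unfolding G_def by (rule mult_carrier_mat[OF car[OF eA] V]) simp
  have GG: "(\<Sum>q<n. cnj (G i $$ (q, x)) * G j $$ (q, y)) = (mat_adjoint V * \<pi> (?e i j) * V) $$ (x, y)"
    if blk: "blk ds i = blk ds j" and ij: "i < ?l" "j < ?l" and xy: "x < r" "y < r" for i j x y
  proof -
    have e: "?e (?s i) i \<in> ?A" "?e (?s j) j \<in> ?A" "?e i (?s i) \<in> ?A" by (auto intro: eA)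
    have "mat_adjoint (G i) * G j = mat_adjoint V * (mat_adjoint (\<pi> (?e (?s i) i)) * \<pi> (?e (?s j) j)) * V"
      unfolding G_def mat_adjoint_mult[OF car[OF e(1)] V]
      using car[OF e(1)] car[OF e(2)] V by (simp add: mat_mult_assoc)
    also have "mat_adjoint (\<pi> (?e (?s i) i)) * \<pi> (?e (?s j) j) = \<pi> (?e i j)"
      using \<pi>_adj[OF e(1)] \<pi>_mult[OF e(3) e(2)] blk_start_cong[OF blk] blk_start_less[OF ij(2)]
      by (simp add: unit_mat_mult_unit_mat)
    finally have "(mat_adjoint V * \<pi> (?e i j) * V) $$ (x, y) = (mat_adjoint (G i) * G j) $$ (x, y)"
      by simp
    also have "\<dots> = (\<Sum>q<n. cnj (G i $$ (q, x)) * G j $$ (q, y))"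
      unfolding mat_mult_entry[OF mat_adjoint_carrier[OF G] G xy]
      using G[of i] xy by (intro sum.cong refl) auto
    finally show ?thesis by simp
  qed
  \<comment> \<open>Row \<open>i\<close> of the operator (\<open>k\<close>, \<open>q\<close>) is row
    \<open>q\<close> of \<open>G i\<close> if \<open>i\<close> lies in block \<open>k\<close>.
    Keeping the blocks in separate operators removes the entries between different blocks.\<close>
  define K where "K = (\<lambda>(k, q) i x. if blk ds i = k then G i $$ (q, x) else 0)"
  define S where "S = {..<length ds} \<times> {..<n}"
  have sum_S: "(\<Sum>kq\<in>S. f kq) = (\<Sum>k<length ds. \<Sum>q<n. f (k, q))" for f :: "_ \<Rightarrow> complex"
    by (simp add: S_def sum.cartesian_product)
  define R where "R = kraus_map r ?l S K"
  \<comment> \<open>The trace condition becomes a sum of compressed diagonal matrix units. By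
    linearity this is \<open>V\<^sup>* \<pi>(1) V\<close>, which is the identity because
    \<open>\<pi>(1) = V V\<^sup>*\<close>.\<close>
  have R: "quantum_channel r ?l R"
    unfolding R_def
  proof (rule kraus_map_channel)
    fix x y assume xy: "x < r" "y < r"
    let ?f = "\<lambda>a. (mat_adjoint V * \<pi> a * V) $$ (x, y)"
    have f_expand: "?f a = (\<Sum>h<n. \<Sum>h'<n. cnj (V $$ (h, x)) * \<pi> a $$ (h, h') * V $$ (h', y))"
      if "a \<in> ?A" for a
      unfolding mat_mult3_entry[OF mat_adjoint_carrier[OF V] car[OF that] V xy]
      using V xy by (intro sum.cong refl) auto
    have A_closed: "a + b \<in> ?A" "z \<cdot>\<^sub>m a \<in> ?A" if "a \<in> ?A" "b \<in> ?A" for a b z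
      using sub that by (simp_all add: star_subalgebra_def)
    have f_add: "?f (a + b) = ?f a + ?f b" if "a \<in> ?A" "b \<in> ?A" for a b
    proof -
      have "\<pi> (a + b) = \<pi> a + \<pi> b" using hom that by (simp add: star_hom_on_def)
      then show ?thesis
        unfolding f_expand[OF A_closed(1)[OF that]] f_expand[OF that(1)] f_expand[OF that(2)]
        using car[OF that(1)] car[OF that(2)] by (simp add: algebra_simps sum.distrib)
    qed
    have f_smult: "?f (z \<cdot>\<^sub>m a) = z * ?f a" if "a \<in> ?A" for a z
      unfolding f_expand[OF A_closed(2)[OF that that]] f_expand[OF that]
      unfolding \<pi>_smult[OF that]
      using car[OF that] by (simp add: sum_distrib_left mult_ac)
    have "(\<Sum>kq\<in>S. \<Sum>i<?l. cnj (K kq i x) * K kq i y)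
      = (\<Sum>k<length ds. \<Sum>i<?l. \<Sum>q<n. cnj (K (k, q) i x) * K (k, q) i y)"
      unfolding sum_S by (intro sum.cong refl sum.swap)
    also have "\<dots> = (\<Sum>i<?l. \<Sum>k<length ds. \<Sum>q<n. cnj (K (k, q) i x) * K (k, q) i y)"
      by (rule sum.swap)
    also have "\<dots> = (\<Sum>i<?l. ?f (?e i i))"
    proof (intro sum.cong refl)
      fix i assume i: "i \<in> {..<?l}"
      have "(\<Sum>k<length ds. \<Sum>q<n. cnj (K (k, q) i x) * K (k, q) i y) =
          (\<Sum>k<length ds. if k = blk ds i then ?f (?e i i) else 0)"
        using i xy by (intro sum.cong refl) (auto simp: K_def GG[OF refl _ _ xy, symmetric])
      then show "(\<Sum>k<length ds. \<Sum>q<n. cnj (K (k, q) i x) * K (k, q) i y) = ?f (?e i i)"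
        using i blk_less[of i ds] by simp
    qed
    also have "\<dots> = (\<Sum>(i, j)\<in>(\<lambda>i. (i, i)) ` {..<?l}. 1\<^sub>m ?l $$ (i, j) * ?f (?e i j))"
      by (subst sum.reindex) (auto simp: inj_on_def)
    also have "\<dots> = ?f (1\<^sub>m ?l)"
      by (rule linear_expand[symmetric, of ?A]) (use A0 A_closed f_add f_smult eA Ac in auto)
    also have "mat_adjoint V * \<pi> (1\<^sub>m ?l) * V = 1\<^sub>m r"
    proof -
      have "mat_adjoint V * \<pi> (1\<^sub>m ?l) * V = (mat_adjoint V * V) * (mat_adjoint V * V)"
        unfolding P[symmetric] VP[symmetric] using V by (simp add: mat_mult_assoc del: VV)
      then show ?thesis by (simp add: VV)
    qed
    finally show "(\<Sum>kq\<in>S. \<Sum>i<?l. cnj (K kq i x) * K kq i y) = (if x = y then 1 else 0)"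
      using xy by simp
  qed
  \<comment> \<open>This identifies \<open>R\<close> as the adjoint of the map that pinches, applies
    \<pi> and compresses by \<open>V\<close>.\<close>
  have R_entry: "R Z $$ (i, j) =
      (if blk ds i = blk ds j then mat_trace (mat_adjoint V * \<pi> (?e j i) * V * Z) else 0)"
    if Z: "Z \<in> carrier_mat r r" and ij: "i < ?l" "j < ?l" for Z i j
  proof (cases "blk ds i = blk ds j")
    case True
    have B: "mat_adjoint V * \<pi> (?e j i) * V \<in> carrier_mat r r"
      by (rule mult_carrier_mat[OF mult_carrier_mat[OF mat_adjoint_carrier[OF V]
            car[OF eA[OF True[symmetric]]]] V])
    have "R Z $$ (i, j) = (\<Sum>k<length ds. if k = blk ds i then
        \<Sum>q<n. \<Sum>x<r. \<Sum>y<r. G i $$ (q, x) * Z $$ (x, y) * cnj (G j $$ (q, y)) else 0)"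
      unfolding R_def kraus_map_entry[OF ij] sum_S
      by (intro sum.cong refl) (simp add: K_def True)
    also have "\<dots> = (\<Sum>q<n. \<Sum>x<r. \<Sum>y<r. G i $$ (q, x) * Z $$ (x, y) * cnj (G j $$ (q, y)))"
      using blk_less[OF ij(1)] by simp
    also have "\<dots> = (\<Sum>x<r. \<Sum>q<n. \<Sum>y<r. G i $$ (q, x) * Z $$ (x, y) * cnj (G j $$ (q, y)))"
      by (rule sum.swap)
    also have "\<dots> = (\<Sum>x<r. \<Sum>y<r. \<Sum>q<n. G i $$ (q, x) * Z $$ (x, y) * cnj (G j $$ (q, y)))"
      by (intro sum.cong refl sum.swap)
    also have "\<dots> = (\<Sum>x<r. \<Sum>y<r. (mat_adjoint V * \<pi> (?e j i) * V) $$ (y, x) * Z $$ (x, y))"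
      by (intro sum.cong refl)
        (simp add: GG[OF True[symmetric] ij(2,1), symmetric] sum_distrib_left mult_ac)
    also have "\<dots> = mat_trace (mat_adjoint V * \<pi> (?e j i) * V * Z)"
      unfolding mat_trace_mult[OF B Z] by (rule sum.swap)
    finally show ?thesis using True by simp
  next
    case False
    have "R Z $$ (i, j) = 0"
      unfolding R_def kraus_map_entry[OF ij] sum_S
      by (intro sum.neutral ballI) (use False in \<open>auto simp: K_def\<close>)
    then show ?thesis using False by simp
  qed

  have lin: "linear_superop n m \<Phi>" "linear_superop m r D"
    using \<Phi> D by (auto simp: quantum_channel_def)
  have comp: "D \<circ> restrict_superop V \<Phi> = D \<circ> (\<Phi> \<circ> (\<lambda>Y. V * Y * mat_adjoint V))"
    by (auto simp: restrict_superop_def)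
  have lin_comp: "linear_superop r r (D \<circ> restrict_superop V \<Phi>)"
    unfolding comp by (intro linear_superop_comp[of r m] linear_superop_comp[of r n]
      conj_linear[OF V] lin)
  have "((R \<circ> D) \<circ> \<Phi> \<circ> E) X = pinching ds X" if X: "X \<in> carrier_mat ?l ?l" for X
  proof (rule eq_matI)
    fix i j assume "i < dim_row (pinching ds X)" "j < dim_col (pinching ds X)"
    then have ij: "i < ?l" "j < ?l" using X by (auto simp: pinching_eq)
    \<comment> \<open>\<open>U\<close> is the isometry \<open>W\<close> in the coordinates of the
      range of \<open>P\<close>; the encoded state then has the form to which the correction
      hypothesis applies.\<close>
    define U where "U = mat_adjoint V * W"
    have U: "U \<in> carrier_mat r ?l" 
      unfolding U_def by (rule mult_carrier_mat[OF mat_adjoint_carrier[OF V] W])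
    have UXU: "U * X * mat_adjoint U \<in> carrier_mat r r"
      by (rule mult_carrier_mat[OF mult_carrier_mat[OF U X] mat_adjoint_carrier[OF U]])
    have VU: "V * U = W"
      unfolding U_def using V W PW VP by (simp add: mat_mult_assoc[symmetric])
    have "E X = V * (U * X * mat_adjoint U) * mat_adjoint V"
    proof -
      have "mat_adjoint W = mat_adjoint U * mat_adjoint V"
        using mat_adjoint_mult[OF V U] VU by simp
      then show ?thesis
        unfolding EX[OF X] using V U X by (simp add: mat_mult_assoc VU[symmetric])
    qed
    then have DE: "D (\<Phi> (E X)) = (D \<circ> restrict_superop V \<Phi>) (U * X * mat_adjoint U)"
      by (simp add: restrict_superop_def)
    have DEc: "D (\<Phi> (E X)) \<in> carrier_mat r r"
      unfolding DE using lin_comp UXU by (simp only: linear_superop_def)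
    show "((R \<circ> D) \<circ> \<Phi> \<circ> E) X $$ (i, j) = pinching ds X $$ (i, j)"
    proof (cases "blk ds i = blk ds j")
      case True
      let ?B = "mat_adjoint V * \<pi> (?e j i) * V"
      have e: "?e j i \<in> ?A" using True by (intro eA) simp
      have B: "?B \<in> carrier_mat r r" 
        by (rule mult_carrier_mat[OF mult_carrier_mat[OF mat_adjoint_carrier[OF V] car[OF e]] V])
      have "((R \<circ> D) \<circ> \<Phi> \<circ> E) X $$ (i, j) = mat_trace (?B * D (\<Phi> (E X)))"
        using R_entry[OF DEc ij] True by simp
      \<comment> \<open>The compressed image \<open>?B\<close> is fixed by the adjoint of the
        corrected channel, so this channel drops out of the trace.\<close>
      also have "\<dots> = mat_trace (?B * (U * X * mat_adjoint U))"
        unfolding DE superop_adjoint(2)[OF lin_comp B UXU] corr[OF e] ..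
      also have "?B * (U * X * mat_adjoint U) = (?B * U * X) * mat_adjoint U"
        using V car[OF e] U X by (simp add: mat_mult_assoc)
      also have "mat_trace \<dots> = mat_trace (mat_adjoint U * (?B * U * X))"
        using B U X by (intro mat_trace_comm[of _ r ?l]) auto
      also have "mat_adjoint U * (?B * U * X) = mat_adjoint W * \<pi> (?e j i) * W * X"
      proof -
        have "mat_adjoint U * (?B * U * X) = mat_adjoint (V * U) * \<pi> (?e j i) * (V * U) * X"
          unfolding mat_adjoint_mult[OF V U] using V U X car[OF e] by (simp add: mat_mult_assoc)
        then show ?thesis by (simp add: VU)
      qed
      also have "\<dots> = ?e j i * X" by (simp add: W\<pi>W[OF e])
      also have "mat_trace \<dots> = X $$ (i, j)" by (rule mat_trace_unit[OF X ij])
      finally show ?thesis using True by (simp add: pinching_entry[OF X ij])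
    next
      case False
      then show ?thesis using R_entry[OF DEc ij] by (simp add: pinching_entry[OF X ij])
    qed
  next
    have "\<Phi> (E X) \<in> carrier_mat m m" "D (\<Phi> (E X)) \<in> carrier_mat r r"
      using lin E X by (auto simp: linear_superop_def quantum_channel_def)
    then have "R (D (\<Phi> (E X))) \<in> carrier_mat ?l ?l" by (simp add: R_def)
    then show "dim_row (((R \<circ> D) \<circ> \<Phi> \<circ> E) X) = dim_row (pinching ds X)"
      "dim_col (((R \<circ> D) \<circ> \<Phi> \<circ> E) X) = dim_col (pinching ds X)"
      using X by (auto simp: pinching_eq)
  qed
  then show ?thesis using E quantum_channel_comp[OF D R] by blast
qed


section \<open>From channels to a transmitted algebra\<close>

text \<open>Closure is inherited along the homomorphism; injectivity keeps the image
  nonzero.\<close>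

lemma star_subalgebra_image:
  assumes sub: "star_subalgebra l A" and hom: "star_hom_on n A \<pi>" and inj: "inj_on \<pi> A"
  shows "star_subalgebra n (\<pi> ` A)"
proof -
  have A: "0\<^sub>m l l \<in> A" "A \<noteq> {0\<^sub>m l l}" "\<And>X Y. X \<in> A \<Longrightarrow> Y \<in> A \<Longrightarrow> X + Y \<in> A \<and> X * Y \<in> A"
    "\<And>c X. X \<in> A \<Longrightarrow> c \<cdot>\<^sub>m X \<in> A" "\<And>X. X \<in> A \<Longrightarrow> mat_adjoint X \<in> A"
    using sub by (auto simp: star_subalgebra_def)
  have \<pi>: "\<And>X. X \<in> A \<Longrightarrow> \<pi> X \<in> carrier_mat n n"
    "\<And>X Y. X \<in> A \<Longrightarrow> Y \<in> A \<Longrightarrow> \<pi> (X + Y) = \<pi> X + \<pi> Y \<and> \<pi> (X * Y) = \<pi> X * \<pi> Y"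
    "\<And>c X. X \<in> A \<Longrightarrow> \<pi> (c \<cdot>\<^sub>m X) = c \<cdot>\<^sub>m \<pi> X"
    "\<And>X. X \<in> A \<Longrightarrow> \<pi> (mat_adjoint X) = mat_adjoint (\<pi> X)"
    using hom by (auto simp: star_hom_on_def)
  have "0 \<cdot>\<^sub>m 0\<^sub>m l l = (0\<^sub>m l l :: complex mat)" "0 \<cdot>\<^sub>m \<pi> (0\<^sub>m l l) = 0\<^sub>m n n"
    using \<pi>(1)[OF A(1)] by (auto intro!: eq_matI)
  then have \<pi>0: "\<pi> (0\<^sub>m l l) = 0\<^sub>m n n" using \<pi>(3)[OF A(1), of 0] by metis
  obtain X where X: "X \<in> A" "X \<noteq> 0\<^sub>m l l" using A(1,2) by blast
  then have "\<pi> X \<noteq> 0\<^sub>m n n" using inj_onD[OF inj _ X(1) A(1)] \<pi>0 by auto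
  then have "\<pi> ` A \<noteq> {0\<^sub>m n n}" using X(1) by blast
  moreover have "0\<^sub>m n n \<in> \<pi> ` A" using A(1) \<pi>0 by (metis imageI)
  moreover have "\<pi> X + \<pi> Y \<in> \<pi> ` A" "\<pi> X * \<pi> Y \<in> \<pi> ` A" if "X \<in> A" "Y \<in> A" for X Y
    using A(3)[OF that] \<pi>(2)[OF that] by (metis imageI)+
  moreover have "c \<cdot>\<^sub>m \<pi> X \<in> \<pi> ` A" "mat_adjoint (\<pi> X) \<in> \<pi> ` A" if "X \<in> A" for c X
    using A(4,5)[OF that] \<pi>(3,4)[OF that] by (metis imageI)+
  ultimately show ?thesis
    unfolding star_subalgebra_def using \<pi>(1) by blast
qed

text \<open>Cancelling \<open>W\<^sup>* W\<close> in the middle of a product gives multiplicativity,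
  and compression by \<open>W\<close> is a left inverse.\<close>

lemma isometry_star_hom:
  assumes W: "W \<in> carrier_mat n l" and WW: "mat_adjoint W * W = 1\<^sub>m l"
    and A: "A \<subseteq> carrier_mat l l"
  shows "star_hom_on n A (\<lambda>a. W * a * mat_adjoint W)"
    and "inj_on (\<lambda>a. W * a * mat_adjoint W) A"
    and "a \<in> A \<Longrightarrow> mat_adjoint W * (W * a * mat_adjoint W) * W = a"
proof -
  have cancel: "mat_adjoint W * (W * M) = M" if "M \<in> carrier_mat l k" for M k
  proof -
    have "mat_adjoint W * (W * M) = (mat_adjoint W * W) * M"
      using W that by (simp add: mat_mult_assoc del: WW)
    then show ?thesis using that by (simp add: WW)
  qed
  show inv: "mat_adjoint W * (W * a * mat_adjoint W) * W = a" if a: "a \<in> A" for a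
  proof -
    have ac: "a \<in> carrier_mat l l" using A a by blast
    have "mat_adjoint W * (W * a * mat_adjoint W) * W = mat_adjoint W * (W * (a * (mat_adjoint W * W)))"
      using W ac by (simp add: mat_mult_assoc del: WW)
    then show ?thesis using cancel[OF ac] ac by (simp add: WW)
  qed
  show "inj_on (\<lambda>a. W * a * mat_adjoint W) A"
    by (rule inj_on_inverseI[of _ "\<lambda>b. mat_adjoint W * b * W"]) (rule inv)
  have mult: "W * (a * b) * mat_adjoint W = (W * a * mat_adjoint W) * (W * b * mat_adjoint W)"
    if "a \<in> carrier_mat l l" "b \<in> carrier_mat l l" for a b
  proof -
    have "(W * a * mat_adjoint W) * (W * b * mat_adjoint W) =
        W * (a * (mat_adjoint W * (W * (b * mat_adjoint W))))"
      using W that by (simp add: mat_mult_assoc)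
    also have "mat_adjoint W * (W * (b * mat_adjoint W)) = b * mat_adjoint W"
      using W that by (intro cancel[of _ n]) simp
    finally show ?thesis using W that by (simp add: mat_mult_assoc)
  qed
  have adj: "W * mat_adjoint a * mat_adjoint W = mat_adjoint (W * a * mat_adjoint W)"
    if a: "a \<in> carrier_mat l l" for a
  proof -
    have "W * a \<in> carrier_mat n l" using W a by simp
    then show ?thesis
      unfolding mat_adjoint_mult[OF \<open>W * a \<in> carrier_mat n l\<close> mat_adjoint_carrier[OF W]]
        mat_adjoint_mult[OF W a]
      using W a by (simp add: mat_mult_assoc)
  qed
  show "star_hom_on n A (\<lambda>a. W * a * mat_adjoint W)"
    unfolding star_hom_on_def using A mult adj conj_linear[OF W]
    by (auto simp: subset_iff linear_superop_def)
qed

text \<open>A vanishing sum of squared moduli. It turns identities summed over all Kraus operators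
  into statements about each one.\<close>

lemma sum_cnj_eq_0_iff:
  fixes z :: "nat \<Rightarrow> nat \<Rightarrow> complex"
  assumes "(\<Sum>b<M. \<Sum>a<N. z b a * cnj (z b a)) = 0" "b < M" "a < N"
  shows "z b a = 0"
proof -
  have "complex_of_real (\<Sum>b<M. \<Sum>a<N. (cmod (z b a))\<^sup>2) = 0"
    using assms(1) by (simp add: complex_norm_square del: of_real_power)
  then have "(\<Sum>b<M. \<Sum>a<N. (cmod (z b a))\<^sup>2) = 0" by (simp only: of_real_eq_0_iff)
  then have "(\<Sum>a<N. (cmod (z b a))\<^sup>2) = 0"
    using assms(2) by (simp add: sum_nonneg_eq_0_iff sum_nonneg)
  then show ?thesis using assms(3) by (simp add: sum_nonneg_eq_0_iff)
qed

lemma channels_imp_transmittable: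
  assumes \<Phi>: "quantum_channel n m \<Phi>" and ds: "0 < sum_list ds"
    and E: "quantum_channel (sum_list ds) n E" and D: "quantum_channel m (sum_list ds) D"
    and DE: "\<And>X. X \<in> carrier_mat (sum_list ds) (sum_list ds) \<Longrightarrow> D (\<Phi> (E X)) = pinching ds X"
  shows "transmittable (sum_list ds) (block_diag_algebra ds) n m \<Phi>"
proof -
  let ?l = "sum_list ds" and ?A = "block_diag_algebra ds"
  let ?s = "blk_start ds"
  define \<Psi> where "\<Psi> = D \<circ> \<Phi>"
  have \<Psi>: "quantum_channel n ?l \<Psi>"
    unfolding \<Psi>_def by (rule quantum_channel_comp[OF \<Phi> D])
  obtain K N where EK: "\<And>X. X \<in> carrier_mat ?l ?l \<Longrightarrow> E X = kraus_map ?l n {..<N::nat} K X"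
    and K: "\<And>i j. i < ?l \<Longrightarrow> j < ?l \<Longrightarrow>
      (\<Sum>a<N. \<Sum>h<n. cnj (K a h i) * K a h j) = (if i = j then 1 else 0)"
    by (rule channel_kraus[OF E]) (rule that, blast+)
  obtain L M where \<Psi>L: "\<And>X. X \<in> carrier_mat n n \<Longrightarrow> \<Psi> X = kraus_map n ?l {..<M::nat} L X"
    by (rule channel_kraus[OF \<Psi>]) (rule that, blast)
  have \<Psi>_tr: "mat_trace (\<Psi> X) = mat_trace X" if "X \<in> carrier_mat n n" for X
    using \<Psi> that by (simp add: quantum_channel_def trace_preserving_def)

  text \<open>The \<open>Q b a\<close> are Kraus operators of \<open>\<Psi> \<circ> E\<close>. Evaluating the pinching on matrix units shows that
    they are diagonal and constant on blocks.\<close>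
  define Q where "Q b a p i = (\<Sum>h<n. L b p h * K a h i)" for b a p i
  have Q_gram: "(\<Sum>b<M. \<Sum>a<N. Q b a p i * cnj (Q b a q j)) =
      (if blk ds i = blk ds j \<and> p = i \<and> q = j then 1 else 0)"
    if ij: "i < ?l" "j < ?l" and pq: "p < ?l" "q < ?l" for i j p q
  proof -
    let ?X = "E (unit_mat ?l i j)"
    have X: "?X \<in> carrier_mat n n" using EK[OF unit_mat_carrier] by simp
    have "pinching ds (unit_mat ?l i j) $$ (p, q) = \<Psi> ?X $$ (p, q)"
      using DE[OF unit_mat_carrier] by (simp add: \<Psi>_def)
    also have "\<dots> = (\<Sum>b<M. \<Sum>h<n. \<Sum>h'<n. L b p h * ?X $$ (h, h') * cnj (L b q h'))"
      unfolding \<Psi>L[OF X] by (rule kraus_map_entry[OF pq])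
    also have "\<dots> = (\<Sum>b<M. \<Sum>h<n. \<Sum>h'<n. \<Sum>a<N. (L b p h * K a h i) * cnj (L b q h' * K a h' j))"
      unfolding EK[OF unit_mat_carrier]
      by (intro sum.cong refl)
        (simp add: kraus_map_unit ij sum_distrib_left sum_distrib_right mult_ac)
    also have "\<dots> = (\<Sum>b<M. \<Sum>h<n. \<Sum>a<N. \<Sum>h'<n. (L b p h * K a h i) * cnj (L b q h' * K a h' j))"
      by (intro sum.cong refl sum.swap)
    also have "\<dots> = (\<Sum>b<M. \<Sum>a<N. \<Sum>h<n. \<Sum>h'<n. (L b p h * K a h i) * cnj (L b q h' * K a h' j))"
      by (intro sum.cong refl sum.swap)
    also have "\<dots> = (\<Sum>b<M. \<Sum>a<N. Q b a p i * cnj (Q b a q j))"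
      unfolding Q_def cnj_sum sum_product ..
    finally show ?thesis using pq by (auto simp: pinching_entry split: if_splits)
  qed
  \<comment> \<open>The squared moduli of these entries add up to the entry (\<open>p\<close>,
    \<open>p\<close>) of the pinched unit at (\<open>i\<close>, \<open>i\<close>), which is
    0.\<close>
  have Q_off: "Q b a p i = 0" if "b < M" "a < N" "i < ?l" "p < ?l" "p \<noteq> i" for b a p i
    by (rule sum_cnj_eq_0_iff[where z = "\<lambda>b a. Q b a p i", OF _ that(1,2)])
      (use Q_gram[of i i p p] that in simp)
  have Q_blk: "Q b a i i = Q b a j j"
    if "b < M" "a < N" "i < ?l" "j < ?l" "blk ds i = blk ds j" for b a i j
  proof -
    \<comment> \<open>The squared norm of the difference expands into four Gram sums: 1 - 1 - 1 +
      1.\<close>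
    have "(\<Sum>b<M. \<Sum>a<N. (Q b a i i - Q b a j j) * cnj (Q b a i i - Q b a j j)) =
        (\<Sum>b<M. \<Sum>a<N. Q b a i i * cnj (Q b a i i)) - (\<Sum>b<M. \<Sum>a<N. Q b a i i * cnj (Q b a j j))
        - (\<Sum>b<M. \<Sum>a<N. Q b a j j * cnj (Q b a i i)) + (\<Sum>b<M. \<Sum>a<N. Q b a j j * cnj (Q b a j j))"
      by (simp add: sum.distrib sum_subtractf algebra_simps)
    also have "\<dots> = 0" using that by (simp add: Q_gram)
    finally show ?thesis
      using sum_cnj_eq_0_iff[where z = "\<lambda>b a. Q b a i i - Q b a j j", OF _ that(1,2)] by simp
  qed
  \<comment> \<open>By \<open>K_gram\<close> below, this is the squared norm of column
    \<open>i\<close> of the Kraus operator \<open>K a\<close>.\<close>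
  define R where "R a i = (\<Sum>b<M. cnj (Q b a i i) * Q b a i i)" for a i
  have R_real: "R a i = complex_of_real (\<Sum>b<M. (cmod (Q b a i i))\<^sup>2)" for a i
    by (simp add: R_def complex_norm_square mult.commute del: of_real_power)
  have R_blk: "R a i = R a j" if "a < N" "i < ?l" "j < ?l" "blk ds i = blk ds j" for a i j
    unfolding R_def using Q_blk[OF _ that] by (intro sum.cong refl) simp

  text \<open>Trace preservation of \<open>\<Psi>\<close> on rank one operators gives the inner products of the columns
    of the Kraus operators of \<open>E\<close>.\<close>
  have K_gram: "(\<Sum>h<n. cnj (K a h i) * K a' h j) =
      (if i = j then \<Sum>b<M. cnj (Q b a i i) * Q b a' i i else 0)"
    if a: "a < N" "a' < N" and ij: "i < ?l" "j < ?l" for a a' i j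
  proof -
    define X where "X = mat n n (\<lambda>(h, h'). K a' h j * cnj (K a h' i))"
    have X: "X \<in> carrier_mat n n" by (simp add: X_def)
    have \<Psi>X: "\<Psi> X \<in> carrier_mat ?l ?l" by (simp add: \<Psi>L[OF X])
    have "(\<Sum>h<n. cnj (K a h i) * K a' h j) = mat_trace X"
      by (simp add: mat_trace_def X_def mult.commute)
    also have "\<dots> = mat_trace (\<Psi> X)" by (rule \<Psi>_tr[OF X, symmetric])
    also have "\<dots> = (\<Sum>p<?l. \<Sum>b<M. \<Sum>h<n. \<Sum>h'<n. L b p h * X $$ (h, h') * cnj (L b p h'))"
      unfolding mat_trace_def carrier_matD(1)[OF \<Psi>X] unfolding \<Psi>L[OF X]
      by (intro sum.cong refl kraus_map_entry) auto
    also have "\<dots> = (\<Sum>p<?l. \<Sum>b<M. \<Sum>h<n. \<Sum>h'<n. (L b p h * K a' h j) * cnj (L b p h' * K a h' i))"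
      by (intro sum.cong refl) (simp add: X_def mult_ac)
    also have "\<dots> = (\<Sum>p<?l. \<Sum>b<M. Q b a' p j * cnj (Q b a p i))"
      unfolding Q_def cnj_sum sum_product ..
    \<comment> \<open>Each \<open>Q b a\<close> is diagonal, so a nonzero term forces
      \<open>p = i\<close> and \<open>p = j\<close>.\<close>
    also have "\<dots> = (\<Sum>p<?l. if p = i then
        (if i = j then \<Sum>b<M. cnj (Q b a i i) * Q b a' i i else 0) else 0)"
    proof (intro sum.cong refl)
      fix p assume p: "p \<in> {..<?l}"
      show "(\<Sum>b<M. Q b a' p j * cnj (Q b a p i)) = (if p = i then
        (if i = j then \<Sum>b<M. cnj (Q b a i i) * Q b a' i i else 0) else 0)"
      proof (cases "p = i \<and> i = j")
        case True
        then show ?thesis by (simp add: mult.commute)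
      next
        case False
        then have "Q b a' p j * cnj (Q b a p i) = 0" if "b < M" for b
          using Q_off[OF that a(1) ij(1), of p] Q_off[OF that a(2) ij(2), of p] p by auto
        then have "(\<Sum>b<M. Q b a' p j * cnj (Q b a p i)) = 0" by (intro sum.neutral) blast
        then show ?thesis using False by auto
      qed
    qed
    also have "\<dots> = (if i = j then \<Sum>b<M. cnj (Q b a i i) * Q b a' i i else 0)" using ij by simp
    finally show ?thesis .
  qed
  \<comment> \<open>Over all \<open>a\<close>, the squared norms of the columns \<open>i\<close> add
    up to 1, because \<open>E\<close> preserves the trace.\<close>
  have "\<exists>a<N. R a i \<noteq> 0" if i: "i < ?l" for i
  proof (rule ccontr)
    assume "\<not> (\<exists>a<N. R a i \<noteq> 0)"
    then have "(\<Sum>a<N. \<Sum>h<n. cnj (K a h i) * K a h i) = 0"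
      using K_gram[OF _ _ i i] by (intro sum.neutral) (auto simp: R_def)
    then show False using K[OF i i] by simp
  qed
  then obtain \<alpha>' where \<alpha>': "\<And>i. i < ?l \<Longrightarrow> \<alpha>' i < N \<and> R (\<alpha>' i) i \<noteq> 0" by metis
  \<comment> \<open>Choosing at the block start makes the chosen Kraus operator the same throughout
    a block.\<close>
  define \<alpha> where "\<alpha> i = \<alpha>' (?s i)" for i
  have \<alpha>_cong: "\<alpha> i = \<alpha> j" if "blk ds i = blk ds j" for i j
    unfolding \<alpha>_def blk_start_cong[OF that] ..
  have \<alpha>: "\<alpha> i < N" "R (\<alpha> i) i \<noteq> 0" if i: "i < ?l" for i
  proof -
    note s = blk_start_less[OF i, of ds]
    show N: "\<alpha> i < N" using \<alpha>'[OF s] by (simp add: \<alpha>_def)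
    have "R (\<alpha> i) i = R (\<alpha> i) (?s i)" by (rule R_blk[OF N i s]) simp
    then show "R (\<alpha> i) i \<noteq> 0" using \<alpha>'[OF s] by (simp add: \<alpha>_def)
  qed
  define \<rho> where "\<rho> i = complex_of_real (sqrt (\<Sum>b<M. (cmod (Q b (\<alpha> i) i i))\<^sup>2))" for i
  have \<rho>: "\<rho> i * \<rho> i = R (\<alpha> i) i" for i
    unfolding \<rho>_def R_real of_real_mult[symmetric] by (simp add: sum_nonneg)
  have \<rho>0: "\<rho> i \<noteq> 0" if "i < ?l" for i using \<rho>[of i] \<alpha>(2)[OF that] by auto
  have cnj_\<rho>: "cnj (\<rho> i) = \<rho> i" for i by (simp add: \<rho>_def)
  have \<rho>_cong: "\<rho> i = \<rho> j" if "i < ?l" "j < ?l" "blk ds i = blk ds j" for i j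
    using Q_blk[OF _ \<alpha>(1)[OF that(2)] that] by (simp add: \<rho>_def \<alpha>_cong[OF that(3)])

  \<comment> \<open>Column \<open>i\<close> is the normalised column \<open>i\<close> of the Kraus
    operator chosen for its block. By \<open>K_gram\<close> different columns are orthogonal even
    when they come from different Kraus operators.\<close>
  define W where "W = mat n ?l (\<lambda>(h, i). K (\<alpha> i) h i / \<rho> i)"
  have W: "W \<in> carrier_mat n ?l" by (simp add: W_def)
  have WW: "mat_adjoint W * W = 1\<^sub>m ?l"
  proof (rule eq_matI)
    fix i j assume "i < dim_row (1\<^sub>m ?l)" "j < dim_col (1\<^sub>m ?l)"
    then have ij: "i < ?l" "j < ?l" by simp_all
    have "(mat_adjoint W * W) $$ (i, j) =
        (\<Sum>h<n. cnj (K (\<alpha> i) h i) * K (\<alpha> j) h j) / (\<rho> i * \<rho> j)"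
      unfolding mat_mult_entry[OF mat_adjoint_carrier[OF W] W ij] sum_divide_distrib
      using ij by (intro sum.cong refl) (simp add: W_def cnj_\<rho>)
    also have "\<dots> = (if i = j then 1 else 0)"
      using K_gram[OF \<alpha>(1)[OF ij(1)] \<alpha>(1)[OF ij(2)] ij] \<rho>[of i] \<rho>0[OF ij(1)]
      by (auto simp: R_def)
    finally show "(mat_adjoint W * W) $$ (i, j) = 1\<^sub>m ?l $$ (i, j)" using ij by simp
  qed (use W in auto)

  \<comment> \<open>The diagonal of the Kraus operator \<open>L b\<close> of \<Psi> multiplied by
    \<open>W\<close>. It is constant on blocks, so this product is central in the algebra.\<close>
  define \<gamma> where "\<gamma> b i = Q b (\<alpha> i) i i / \<rho> i" for b i
  have \<gamma>_cong: "\<gamma> b i = \<gamma> b j" if "b < M" "i < ?l" "j < ?l" "blk ds i = blk ds j" for b i j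
    using Q_blk[OF that(1) \<alpha>(1)[OF that(3)] that(2-)]
    by (simp add: \<gamma>_def \<alpha>_cong[OF that(4)] \<rho>_cong[OF that(2-)])
  have \<gamma>_sum: "(\<Sum>b<M. \<gamma> b i * cnj (\<gamma> b i)) = 1" if "i < ?l" for i
  proof -
    have "(\<Sum>b<M. \<gamma> b i * cnj (\<gamma> b i)) = R (\<alpha> i) i / (\<rho> i * \<rho> i)"
      unfolding R_def sum_divide_distrib by (simp add: \<gamma>_def cnj_\<rho> mult.commute)
    then show ?thesis using \<rho>[of i] \<alpha>(2)[OF that] by simp
  qed
  \<comment> \<open>Only entries inside the diagonal blocks are recovered: between blocks the factor
    would be the sum of the \<open>\<gamma> b p * cnj (\<gamma> b q)\<close>, which may differ from
    1.\<close>
  have \<Psi>W: "\<Psi> (W * Y * mat_adjoint W) $$ (p, q) = Y $$ (p, q)"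
    if Y: "Y \<in> carrier_mat ?l ?l" and pq: "p < ?l" "q < ?l" "blk ds p = blk ds q" for Y p q
  proof -
    have WY: "W * Y * mat_adjoint W \<in> carrier_mat n n"
      by (rule mult_carrier_mat[OF mult_carrier_mat[OF W Y] mat_adjoint_carrier[OF W]])
    define T where "T b = mat ?l n (\<lambda>(p, h). L b p h)" for b
    have T: "T b \<in> carrier_mat ?l n" for b by (simp add: T_def)
    have TW: "T b * W \<in> carrier_mat ?l ?l" for b by (rule mult_carrier_mat[OF T W])
    have TW_entry: "(T b * W) $$ (p, i) = (if i = p then \<gamma> b p else 0)"
      if "b < M" "p < ?l" "i < ?l" for b p i
    proof -
      have "(T b * W) $$ (p, i) = Q b (\<alpha> i) p i / \<rho> i"
        unfolding mat_mult_entry[OF T W that(2,3)] Q_def sum_divide_distrib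
        using that by (intro sum.cong refl) (simp add: T_def W_def)
      then show ?thesis
        using Q_off[OF that(1) \<alpha>(1)[OF that(3)] that(3,2)] by (auto simp: \<gamma>_def)
    qed
    have "\<Psi> (W * Y * mat_adjoint W) $$ (p, q) =
        (\<Sum>b<M. (T b * (W * Y * mat_adjoint W) * mat_adjoint (T b)) $$ (p, q))"
      unfolding \<Psi>L[OF WY] kraus_map_entry[OF pq(1,2)] mat_mult_adjoint_entry[OF T WY pq(1,2)]
      using pq by (intro sum.cong refl) (simp add: T_def)
    also have "\<dots> = (\<Sum>b<M. Y $$ (p, q) * (\<gamma> b p * cnj (\<gamma> b p)))"
    proof (intro sum.cong refl)
      fix b assume b: "b \<in> {..<M}"
      have "T b * (W * Y * mat_adjoint W) * mat_adjoint (T b) =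
          T b * W * Y * mat_adjoint (T b * W)"
        unfolding mat_adjoint_mult[OF T W] using T[of b] W Y by (simp add: mat_mult_assoc)
      then have "(T b * (W * Y * mat_adjoint W) * mat_adjoint (T b)) $$ (p, q) =
        (\<Sum>i<?l. \<Sum>j<?l. (T b * W) $$ (p, i) * Y $$ (i, j) * cnj ((T b * W) $$ (q, j)))"
        using mat_mult_adjoint_entry[OF TW Y pq(1,2)] by simp
      also have "\<dots> = (\<Sum>i<?l. \<Sum>j<?l. if j = q then if i = p then
          Y $$ (p, q) * (\<gamma> b p * cnj (\<gamma> b q)) else 0 else 0)"
        using b pq by (intro sum.cong refl) (auto simp: TW_entry)
      also have "\<dots> = Y $$ (p, q) * (\<gamma> b p * cnj (\<gamma> b q))" using pq by simp
      finally show "(T b * (W * Y * mat_adjoint W) * mat_adjoint (T b)) $$ (p, q) =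
          Y $$ (p, q) * (\<gamma> b p * cnj (\<gamma> b p))"
        using \<gamma>_cong[of b p q] b pq by simp
    qed
    also have "\<dots> = Y $$ (p, q)"
      unfolding sum_distrib_left[symmetric] \<gamma>_sum[OF pq(1)] by simp
    finally show ?thesis .
  qed

  define \<pi> where "\<pi> a = W * a * mat_adjoint W" for a
  have A: "?A \<subseteq> carrier_mat ?l ?l" using block_diag_algebra_carrier by blast
  have hom: "star_hom_on n ?A \<pi>" and inj: "inj_on \<pi> ?A"
    and inv: "mat_adjoint W * \<pi> a * W = a" if "a \<in> ?A" for a
    unfolding \<pi>_def using isometry_star_hom[OF W WW A] that by blast+
  have sub: "star_subalgebra ?l ?A" by (rule star_subalgebra_block_diag[OF ds])
  have A1: "1\<^sub>m ?l \<in> ?A" by (rule one_in_block_diag_algebra)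
  have "is_unit_of (\<pi> ` ?A) (\<pi> (1\<^sub>m ?l))"
  proof -
    have "\<pi> (1\<^sub>m ?l) * \<pi> a = \<pi> a" "\<pi> a * \<pi> (1\<^sub>m ?l) = \<pi> a" if a: "a \<in> ?A" for a
    proof -
      have "\<pi> (1\<^sub>m ?l * a) = \<pi> (1\<^sub>m ?l) * \<pi> a" "\<pi> (a * 1\<^sub>m ?l) = \<pi> a * \<pi> (1\<^sub>m ?l)"
        using hom[OF A1] a A1 by (auto simp: star_hom_on_def)
      then show "\<pi> (1\<^sub>m ?l) * \<pi> a = \<pi> a" "\<pi> a * \<pi> (1\<^sub>m ?l) = \<pi> a"
        using block_diag_algebra_carrier[OF a] by simp_all
    qed
    then show ?thesis using A1 by (auto simp: is_unit_of_def)
  qed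
  \<comment> \<open>The unit of the image is \<open>W W\<^sup>*\<close>, so \<open>W\<close> itself
    serves as the inclusion of its range.\<close>
  moreover have "is_range_inclusion n (\<pi> (1\<^sub>m ?l)) ?l W"
    using W WW by (simp add: is_range_inclusion_def \<pi>_def)
  moreover have "superop_adjoint ?l ?l (D \<circ> restrict_superop W \<Phi>) a = a" if a: "a \<in> ?A" for a
  proof -
    note ac = block_diag_algebra_carrier[OF a]
    have eq: "(D \<circ> restrict_superop W \<Phi>) Y = \<Psi> (W * Y * mat_adjoint W)" for Y
      by (simp add: restrict_superop_def \<Psi>_def)
    have "D \<circ> restrict_superop W \<Phi> = \<Psi> \<circ> (\<lambda>Y. W * Y * mat_adjoint W)"
      by (rule ext) (simp add: restrict_superop_def \<Psi>_def)
    then have lin: "linear_superop ?l ?l (D \<circ> restrict_superop W \<Phi>)"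
      using linear_superop_comp[OF conj_linear[OF W]] \<Psi> by (simp add: quantum_channel_def)
    have "mat_trace (a * (D \<circ> restrict_superop W \<Phi>) Y) = mat_trace (a * Y)"
      if Y: "Y \<in> carrier_mat ?l ?l" for Y
    proof -
      have "(D \<circ> restrict_superop W \<Phi>) Y \<in> carrier_mat ?l ?l"
        using lin Y unfolding linear_superop_def by blast
      then have c: "\<Psi> (W * Y * mat_adjoint W) \<in> carrier_mat ?l ?l" by (simp only: eq)
      \<comment> \<open>Where the channel may alter \<open>Y\<close>, between different blocks, the
        entry of \<open>a\<close> is 0.\<close>
      have "a $$ (i, j) * \<Psi> (W * Y * mat_adjoint W) $$ (j, i) = a $$ (i, j) * Y $$ (j, i)"
        if "i < ?l" "j < ?l" for i j
        using \<Psi>W[OF Y that(2,1)] block_diag_algebra_off_diag[OF a that]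
        by (cases "blk ds i = blk ds j") auto
      then show ?thesis unfolding eq mat_trace_mult[OF ac c] mat_trace_mult[OF ac Y]
        by (intro sum.cong refl) blast
    qed
    then show ?thesis
      unfolding superop_adjoint_def
      using ac by (intro the1_equality[OF superop_adjoint_ex1[OF lin ac]]) blast
  qed
  then have "\<forall>X \<in> (\<lambda>B. mat_adjoint W * B * W) ` \<pi> ` ?A.
      superop_adjoint ?l ?l (D \<circ> restrict_superop W \<Phi>) X = X"
    by (simp add: inv)
  ultimately have "correctable n m \<Phi> (\<pi> ` ?A)"
    unfolding correctable_def
    using star_subalgebra_image[OF sub hom[OF A1] inj[OF A1]] D by blast
  then show ?thesis
    unfolding transmittable_def using sub hom[OF A1] inj[OF A1] by blast
qed

theorem lemma3p3:
  fixes n m :: nat and \<Phi> :: "complex mat \<Rightarrow> complex mat" and ds :: "nat list"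
  assumes "quantum_channel n m \<Phi>"
    and "ds \<noteq> []" and "\<forall>d \<in> set ds. 0 < d"
  shows "(\<forall>F. conditional_expectation (sum_list ds) (block_diag_algebra ds) F \<and>
              trace_preserving (sum_list ds) F \<longleftrightarrow>
            (\<forall>X \<in> carrier_mat (sum_list ds) (sum_list ds). F X = pinching ds X)) \<and>
         (transmittable (sum_list ds) (block_diag_algebra ds) n m \<Phi> \<longleftrightarrow>
            (\<exists>\<E> \<D>. quantum_channel (sum_list ds) n \<E> \<and> quantum_channel m (sum_list ds) \<D> \<and>
               (\<forall>X \<in> carrier_mat (sum_list ds) (sum_list ds).
                  (\<D> \<circ> \<Phi> \<circ> \<E>) X = pinching ds X)))"
proof -
  \<comment> \<open>Positive total dimension makes the algebra nonzero, as
    \<open>star_subalgebra\<close> demands.\<close>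
  have "0 < sum_list ds" using assms(2,3) by (cases ds) auto
  then show ?thesis
    using trace_preserving_conditional_expectation_iff[of ds]
      transmittable_imp_channels[OF assms(1), of ds] channels_imp_transmittable[OF assms(1), of ds]
    by auto
qed

end
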